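(* Let $\Phi\colon\mathbb{R}^n\to\mathbb{R}$ be a convex function for which there are constants $C,\delta\ge0$ such that $|\Phi(\mathbf{x})-\Phi(\mathbf{y})|\le C\|\mathbf{x}-\mathbf{y}\|(1+\|\mathbf{x}\|^\delta+\|\mathbf{y}\|^\delta)$ for all $\mathbf{x},\mathbf{y}\in\mathbb{R}^n$. Let $U\colon\mathbb{R}^n\to(-\infty,0]$ be a piecewise affine concave function, $\mathbf{u}_0\in\mathbb{R}^n$ a vector such that $\mathbf{x}\mapsto U(\mathbf{x}+\mathbf{u}_0)$ is 1-homogeneous, and $P$ an invertible $n\times n$ matrix whose column vectors $\mathbf{u}_1,\dots,\mathbf{u}_n$ satisfy $$\{\mathbf{x}\in\mathbb{R}^n\colon U(\mathbf{x}+\mathbf{u}_0)\ge-1\}=\mathrm{co}\left(\bigcup_{j=1}^n\left\{\frac1{a_j}\mathbf{u}_j,-\frac1{b_j}\mathbf{u}_j\right\}\right)$$ for some $a_1,\dots,a_n,b_1,\dots,b_n>0$. Let $M=PP^T$. Let $\mathbf{x}\in\mathbb{R}^n$ and $t>0$, and let $\mathbf{p}^*=(p_1^*,\dots,p_n^* )$ be the unique maximizer in $$V(\mathbf{x},t)=\sup_{\mathbf{p}\in\mathbb{R}^n}\left\{\sum_{i=1}^nV\left((P^{-1}\mathbf{x}-P^{-1}\mathbf{u}_0)_i,t;p_i,a_i,b_i\right)-\tilde\Phi^*(\mathbf{p})\right\},$$ where $V(x,t;p,a,b)$ is the explicit function given in the context and $\tilde\Phi^*$ is the Legendre-Fenchel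 transform of $\tilde\Phi(\mathbf{y}):=\Phi(P\mathbf{y}+\mathbf{u}_0)$. Then the unique optimal trajectory of the optimal control problem $$\inf\left\{\int_0^t\left(\frac12\|\dot{\mathbf{x}}(s)\|_{M^{-1}}^2-U(\mathbf{x}(s))\right)ds+\Phi(\mathbf{x}(0))\colon\mathbf{x}(t)=\mathbf{x}\right\},$$ where the infimum is over Lipschitz functions $\mathbf{x}(\cdot)\colon[0,t]\to\mathbb{R}^n$, is $$[0,t]\ni s\mapsto\boldsymbol\gamma(s;\mathbf{x},t):=P\left(\gamma(s;y_1,t,p_1^*,a_1,b_1),\dots,\gamma(s;y_n,t,p_n^*,a_n,b_n)\right)^T+\mathbf{u}_0,\qquad\mathbf{y}=(y_1,\dots,y_n):=P^{-1}(\mathbf{x}-\mathbf{u}_0),$$ where $\gamma(s;x,t,p,a,b)$ is the explicit trajectory given in the context. Moreover, the optimal value of this problem equals $V(\mathbf{x},t)$.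
   Context: Explicit function. For $a,b>0$, $x,p\in\mathbb{R}$, $t\ge0$, define $V(x,t;p,a,b)$ as follows. If $p\ge0$, then $V(x,t;p,a,b)=f_i(x,t;p,a,b)$ whenever $(x,t,p)\in\Omega_i$, $i=1,\dots,5$, where (the regions depend on $a,b$, are subsets of $\mathbb{R}\times[0,+\infty)\times[0,+\infty)$, and partition it) $\Omega_1=\{x\ge pt+\frac a2t^2\}$; $\Omega_2=\{x<0,\ t<\frac pb\}\cup\{x<-\frac b2(t-\frac pb)^2,\ t\ge\frac pb\}$; $\Omega_3=\{0\le x<pt+\frac a2t^2,\ t<\frac pb\}\cup\{\frac a2(t-\frac pb)^2\le x<pt+\frac a2t^2,\ t\ge\frac pb\}$; $\Omega_4=\{0\le x<\frac a2(t-\frac pb)^2,\ t\ge\frac pb\}$; $\Omega_5=\{-\frac b2(t-\frac pb)^2\le x<0,\ t\ge\frac pb\}$; and $f_1=-\frac{a^2}{6}t^3-\frac a2pt^2+atx-\frac12p^2t+px$; $f_2=-\frac{b^2}{6}t^3+\frac b2pt^2-\frac12p^2t+px-btx$; $f_3=\frac{a+b}{3(a+2b)^2}\left((bt-p)^3+((bt-p)^2+2x(a+2b))^{3/2}\right)-\frac{b}{a+2b}(bt-p)x-\frac{b^2}{6}t^3+\frac b2pt^2-\frac12p^2t$; $f_4=\frac{a^2}{3}\left(\frac{2x}{a}\right)^{3/2}-\frac{p^3}{6b}$; $f_5=\frac{b^2}{3}\left(\frac{-2x}{b}\right)^{3/2}-\frac{p^3}{6b}$. If $p<0$, then $V(x,t;p,a,b)=V(-x,t;-p,b,a)$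 (the right-hand side being given by the case $-p>0$ with $a$ and $b$ exchanged). Explicit trajectory. For $a,b>0$, $x,p\in\mathbb{R}$, $t>0$, $s\in[0,t]$, define $\gamma(s;x,t,p,a,b)$ as follows. If $p\ge0$: - $(x,t,p)\in\Omega_1$: $\gamma=x-p(t-s)-\frac a2(t^2-s^2)$. - $(x,t,p)\in\Omega_2$: $\gamma=x-p(t-s)+\frac b2(t^2-s^2)$. - $(x,t,p)\in\Omega_3$: with $\tau=\frac{(a+b)t+p-\sqrt{(bt-p)^2+2(2b+a)x}}{2b+a}\in[0,t]$, $\gamma=-p(\tau-s)+\frac b2(\tau^2-s^2)$ for $s\in[0,\tau)$ and $\gamma=(p-b\tau)(s-\tau)+\frac a2(s-\tau)^2$ for $s\in[\tau,t]$. - $(x,t,p)\in\Omega_4$: $\gamma=-\frac1{2b}(p-bs)^2$ for $s\in[0,\frac pb)$; $\gamma=0$ for $s\in[\frac pb,t-\sqrt{2x/a})$; $\gamma=\frac a2\left(s-t+\sqrt{2x/a}\right)^2$ for $s\in[t-\sqrt{2x/a},t]$. - $(x,t,p)\in\Omega_5$: $\gamma=-\frac1{2b}(p-bs)^2$ for $s\in[0,\frac pb)$; $\gamma=0$ for $s\in[\frac pb,t-\sqrt{2|x|/b})$; $\gamma=-\frac b2\left(s-t+\sqrt{2|x|/b}\right)^2$ for $s\in[t-\sqrt{2|x|/b},t]$. If $p<0$: $\gamma(s;x,t,p,a,b)=-\gamma(s;-x,t,-p,b,a)$. Other notation. The Legendre-Fenchel transform is $g^*(\mathbf{p})=\sup_{\mathbf{x}}\{\langle\mathbf{p},\mathbf{x}\rangle-g(\mathbf{x})\}\in\mathbb{R}\cup\{+\infty\}$.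 $\|\cdot\|$ is the Euclidean norm; $\|\mathbf{v}\|_{M^{-1}}=\sqrt{\langle\mathbf{v},M^{-1}\mathbf{v}\rangle}$. $\mathrm{co}\,E$ is the convex hull of $E$. A function $g$ is 1-homogeneous if $g(\lambda\mathbf{x})=\lambda g(\mathbf{x})$ for all $\lambda\geq 0$. $(\mathbf{v})_i$ is the $i$-th component of $\mathbf{v}$. For $t>0$ the maximizer $\mathbf{p}^*$ exists and is unique. An optimal trajectory is an admissible trajectory attaining the infimum. *)

theory Defs
  imports "HOL-Analysis.Analysis"
begin

subsection \<open>The explicit one-dimensional value function\<close>

text \<open>The regions are sets of triples (x, t, p). For \<open>a, b > 0\<close> they partition the triples with
  \<open>t \<ge> 0\<close> and \<open>p \<ge> 0\<close>.\<close>

definition Omega1 :: "real \<Rightarrow> real \<Rightarrow> (real \<times> real \<times> real) set" where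
  "Omega1 a b = {(x, t, p). 0 \<le> t \<and> 0 \<le> p \<and> x \<ge> p * t + a / 2 * t\<^sup>2}"

definition Omega2 :: "real \<Rightarrow> real \<Rightarrow> (real \<times> real \<times> real) set" where
  "Omega2 a b = {(x, t, p). 0 \<le> t \<and> 0 \<le> p \<and>
     (x < 0 \<and> t < p / b \<or> x < - (b / 2) * (t - p / b)\<^sup>2 \<and> t \<ge> p / b)}"

definition Omega3 :: "real \<Rightarrow> real \<Rightarrow> (real \<times> real \<times> real) set" where
  "Omega3 a b = {(x, t, p). 0 \<le> t \<and> 0 \<le> p \<and>
     (0 \<le> x \<and> x < p * t + a / 2 * t\<^sup>2 \<and> t < p / b \<or>
      a / 2 * (t - p / b)\<^sup>2 \<le> x \<and> x < p * t + a / 2 * t\<^sup>2 \<and> t \<ge> p / b)}"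

definition Omega4 :: "real \<Rightarrow> real \<Rightarrow> (real \<times> real \<times> real) set" where
  "Omega4 a b = {(x, t, p). 0 \<le> t \<and> 0 \<le> p \<and>
     0 \<le> x \<and> x < a / 2 * (t - p / b)\<^sup>2 \<and> t \<ge> p / b}"

definition Omega5 :: "real \<Rightarrow> real \<Rightarrow> (real \<times> real \<times> real) set" where
  "Omega5 a b = {(x, t, p). 0 \<le> t \<and> 0 \<le> p \<and>
     - (b / 2) * (t - p / b)\<^sup>2 \<le> x \<and> x < 0 \<and> t \<ge> p / b}"

definition f1 :: "real \<Rightarrow> real \<Rightarrow> real \<Rightarrow> real \<Rightarrow> real \<Rightarrow> real" where
  "f1 x t p a b = - (a\<^sup>2 / 6) * t ^ 3 - a / 2 * p * t\<^sup>2 + a * t * x - 1 / 2 * p\<^sup>2 * t + p * x"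

definition f2 :: "real \<Rightarrow> real \<Rightarrow> real \<Rightarrow> real \<Rightarrow> real \<Rightarrow> real" where
  "f2 x t p a b = - (b\<^sup>2 / 6) * t ^ 3 + b / 2 * p * t\<^sup>2 - 1 / 2 * p\<^sup>2 * t + p * x - b * t * x"

definition f3 :: "real \<Rightarrow> real \<Rightarrow> real \<Rightarrow> real \<Rightarrow> real \<Rightarrow> real" where
  "f3 x t p a b =
     (a + b) / (3 * (a + 2 * b)\<^sup>2) *
       ((b * t - p) ^ 3 + ((b * t - p)\<^sup>2 + 2 * x * (a + 2 * b)) powr (3 / 2))
     - b / (a + 2 * b) * (b * t - p) * x
     - b\<^sup>2 / 6 * t ^ 3 + b / 2 * p * t\<^sup>2 - 1 / 2 * p\<^sup>2 * t"

definition f4 :: "real \<Rightarrow> real \<Rightarrow> real \<Rightarrow> real \<Rightarrow> real \<Rightarrow> real" where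
  "f4 x t p a b = a\<^sup>2 / 3 * (2 * x / a) powr (3 / 2) - p ^ 3 / (6 * b)"

definition f5 :: "real \<Rightarrow> real \<Rightarrow> real \<Rightarrow> real \<Rightarrow> real \<Rightarrow> real" where
  "f5 x t p a b = b\<^sup>2 / 3 * (- 2 * x / b) powr (3 / 2) - p ^ 3 / (6 * b)"

definition V_nonneg :: "real \<Rightarrow> real \<Rightarrow> real \<Rightarrow> real \<Rightarrow> real \<Rightarrow> real" where
  "V_nonneg x t p a b =
     (if (x, t, p) \<in> Omega1 a b then f1 x t p a b
      else if (x, t, p) \<in> Omega2 a b then f2 x t p a b
      else if (x, t, p) \<in> Omega3 a b then f3 x t p a b
      else if (x, t, p) \<in> Omega4 a b then f4 x t p a b
      else if (x, t, p) \<in> Omega5 a b then f5 x t p a b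
      else undefined)"

definition V_scalar :: "real \<Rightarrow> real \<Rightarrow> real \<Rightarrow> real \<Rightarrow> real \<Rightarrow> real" where
  "V_scalar x t p a b = (if p \<ge> 0 then V_nonneg x t p a b else V_nonneg (- x) t (- p) b a)"

subsection \<open>The explicit one-dimensional trajectory\<close>

definition tau :: "real \<Rightarrow> real \<Rightarrow> real \<Rightarrow> real \<Rightarrow> real \<Rightarrow> real" where
  "tau x t p a b =
     ((a + b) * t + p - sqrt ((b * t - p)\<^sup>2 + 2 * (2 * b + a) * x)) / (2 * b + a)"

definition gamma_nonneg :: "real \<Rightarrow> real \<Rightarrow> real \<Rightarrow> real \<Rightarrow> real \<Rightarrow> real \<Rightarrow> real" where
  "gamma_nonneg s x t p a b =
     (if (x, t, p) \<in> Omega1 a b then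
        x - p * (t - s) - a / 2 * (t\<^sup>2 - s\<^sup>2)
      else if (x, t, p) \<in> Omega2 a b then
        x - p * (t - s) + b / 2 * (t\<^sup>2 - s\<^sup>2)
      else if (x, t, p) \<in> Omega3 a b then
        (let \<tau> = tau x t p a b in
         if s < \<tau> then - p * (\<tau> - s) + b / 2 * (\<tau>\<^sup>2 - s\<^sup>2)
         else (p - b * \<tau>) * (s - \<tau>) + a / 2 * (s - \<tau>)\<^sup>2)
      else if (x, t, p) \<in> Omega4 a b then
        (if s < p / b then - (1 / (2 * b)) * (p - b * s)\<^sup>2
         else if s < t - sqrt (2 * x / a) then 0
         else a / 2 * (s - t + sqrt (2 * x / a))\<^sup>2)
      else if (x, t, p) \<in> Omega5 a b then
        (if s < p / b then - (1 / (2 * b)) * (p - b * s)\<^sup>2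
         else if s < t - sqrt (2 * \<bar>x\<bar> / b) then 0
         else - (b / 2) * (s - t + sqrt (2 * \<bar>x\<bar> / b))\<^sup>2)
      else undefined)"

definition gamma_scalar :: "real \<Rightarrow> real \<Rightarrow> real \<Rightarrow> real \<Rightarrow> real \<Rightarrow> real \<Rightarrow> real" where
  "gamma_scalar s x t p a b =
     (if p \<ge> 0 then gamma_nonneg s x t p a b else - gamma_nonneg s (- x) t (- p) b a)"

subsection \<open>Notions from convex analysis\<close>

definition legendre_fenchel :: "('a::euclidean_space \<Rightarrow> real) \<Rightarrow> 'a \<Rightarrow> ereal" where
  "legendre_fenchel g p = (SUP x. ereal (p \<bullet> x - g x))"

definition one_homogeneous :: "('a::real_vector \<Rightarrow> real) \<Rightarrow> bool" where
  "one_homogeneous g \<longleftrightarrow> (\<forall>r\<ge>0. \<forall>x. g (r *\<^sub>R x) = r * g x)"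

definition piecewise_affine :: "('a::euclidean_space \<Rightarrow> real) \<Rightarrow> bool" where
  "piecewise_affine f \<longleftrightarrow>
     (\<exists>\<C>. finite \<C> \<and> \<Union>\<C> = UNIV \<and>
        (\<forall>C\<in>\<C>. polyhedron C \<and> (\<exists>c d. \<forall>x\<in>C. f x = c \<bullet> x + d)))"

text \<open>Powers \<open>r\<^sup>d\<close> with \<open>r, d \<ge> 0\<close> and the convention \<open>0\<^sup>0 = 1\<close>; note that \<open>0 powr 0 = 0\<close>.\<close>

definition nonneg_power :: "real \<Rightarrow> real \<Rightarrow> real" where
  "nonneg_power r d = (if d = 0 then 1 else r powr d)"

text \<open>With \<open>A = matrix_inv M\<close> this is the norm with subscript \<open>M\<^sup>-\<^sup>1\<close>.\<close>

definition weighted_norm :: "real^'n^'n \<Rightarrow> real^'n \<Rightarrow> real" where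
  "weighted_norm A v = sqrt (v \<bullet> (A *v v))"

subsection \<open>The optimal control problem\<close>

definition admissible :: "real^'n \<Rightarrow> real \<Rightarrow> (real \<Rightarrow> real^'n) set" where
  "admissible x t = {X. (\<exists>L. L-lipschitz_on {0..t} X) \<and> X t = x}"

text \<open>A Lipschitz curve is differentiable almost everywhere on \<open>[0, t]\<close>; the null set on which
  \<open>vector_derivative\<close> is an arbitrary vector does not affect the Lebesgue integral.\<close>

definition cost ::
  "real^'n^'n \<Rightarrow> (real^'n \<Rightarrow> real) \<Rightarrow> (real^'n \<Rightarrow> real) \<Rightarrow> real \<Rightarrow> (real \<Rightarrow> real^'n) \<Rightarrow> real" where
  "cost M U \<Phi> t X =
     (LINT s:{0..t}|lebesgue.
        1 / 2 * (weighted_norm (matrix_inv M) (vector_derivative X (at s within {0..t})))\<^sup>2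
        - U (X s))
     + \<Phi> (X 0)"

definition optimal_value ::
  "real^'n^'n \<Rightarrow> (real^'n \<Rightarrow> real) \<Rightarrow> (real^'n \<Rightarrow> real) \<Rightarrow> real^'n \<Rightarrow> real \<Rightarrow> ereal" where
  "optimal_value M U \<Phi> x t = (INF X\<in>admissible x t. ereal (cost M U \<Phi> t X))"

definition optimal_trajectory ::
  "real^'n^'n \<Rightarrow> (real^'n \<Rightarrow> real) \<Rightarrow> (real^'n \<Rightarrow> real) \<Rightarrow> real^'n \<Rightarrow> real \<Rightarrow>
     (real \<Rightarrow> real^'n) \<Rightarrow> bool" where
  "optimal_trajectory M U \<Phi> x t X \<longleftrightarrow>
     X \<in> admissible x t \<and> ereal (cost M U \<Phi> t X) = optimal_value M U \<Phi> x t"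

subsection \<open>The representation formula and the explicit trajectory\<close>

definition V_objective ::
  "real^'n^'n \<Rightarrow> real^'n \<Rightarrow> real^'n \<Rightarrow> real^'n \<Rightarrow> (real^'n \<Rightarrow> real) \<Rightarrow> real^'n \<Rightarrow> real \<Rightarrow>
     real^'n \<Rightarrow> ereal" where
  "V_objective P u0 a b \<Phi> x t p =
     ereal (\<Sum>i\<in>UNIV.
       V_scalar ((matrix_inv P *v x - matrix_inv P *v u0) $ i) t (p $ i) (a $ i) (b $ i))
     - legendre_fenchel (\<lambda>y. \<Phi> (P *v y + u0)) p"

definition V_value ::
  "real^'n^'n \<Rightarrow> real^'n \<Rightarrow> real^'n \<Rightarrow> real^'n \<Rightarrow> (real^'n \<Rightarrow> real) \<Rightarrow> real^'n \<Rightarrow> real \<Rightarrow> ereal" where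
  "V_value P u0 a b \<Phi> x t = (SUP p. V_objective P u0 a b \<Phi> x t p)"

definition V_maximizer ::
  "real^'n^'n \<Rightarrow> real^'n \<Rightarrow> real^'n \<Rightarrow> real^'n \<Rightarrow> (real^'n \<Rightarrow> real) \<Rightarrow> real^'n \<Rightarrow> real \<Rightarrow>
     real^'n \<Rightarrow> bool" where
  "V_maximizer P u0 a b \<Phi> x t p \<longleftrightarrow> V_objective P u0 a b \<Phi> x t p = V_value P u0 a b \<Phi> x t"

definition gamma_curve ::
  "real^'n^'n \<Rightarrow> real^'n \<Rightarrow> real^'n \<Rightarrow> real^'n \<Rightarrow> real^'n \<Rightarrow> real \<Rightarrow> real^'n \<Rightarrow> real \<Rightarrow> real^'n" where
  "gamma_curve P u0 a b x t p s =
     (let y = matrix_inv P *v (x - u0)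
      in P *v (\<chi> i. gamma_scalar s (y $ i) t (p $ i) (a $ i) (b $ i)) + u0)"

end

theory Submission
  imports Defs
begin

text \<open>In the coordinates \<open>y = P\<^sup>-\<^sup>1 (x - u0)\<close> the running cost is a sum of scalar costs
  \<open>y'\<^sup>2 / 2 + \<phi> y\<close>, where \<open>\<phi> y\<close> is \<open>a * y\<close> for \<open>y \<ge> 0\<close> and \<open>- b * y\<close> otherwise. With the linear initial
  cost \<open>p * y 0\<close> the explicit curve \<open>\<gamma>\<close> solves the Euler--Lagrange inclusion with \<open>\<gamma>' 0 = p\<close>, and convexity
  shows that any competitor with the same endpoint costs at least the explicit value plus half the
  squared \<open>L\<^sup>2\<close> distance of the speeds. Hence the value is concave in \<open>p\<close> with gradient \<open>\<gamma> 0\<close>, and \<open>\<gamma> 0\<close> is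
  Lipschitz in \<open>p\<close>. At a maximiser \<open>p\<close> of the dual problem this gives equality in the Fenchel--Young
  inequality for the initial cost at \<open>\<gamma> 0\<close>, so the lower bound for \<open>p\<close> is attained by \<open>\<gamma>\<close> and only by \<open>\<gamma>\<close>.
  Since \<open>\<gamma>' 0 = p\<close>, uniqueness of the curve also gives uniqueness of \<open>p\<close>.

  The cost of an arbitrary Lipschitz curve is meaningful only because Lipschitz functions are
  differentiable almost everywhere; this is derived from the Vitali covering theorem.\<close>

text \<open>Scalar problems appear because the level set of \<open>U\<close> is a skew
  cross-polytope spanned by the columns of \<open>P\<close>: \<open>- U\<close> is its gauge, and
  that gauge is a sum over coordinates. Only \<Phi> couples the coordinates. Replacing it by an
  affine minorant of slope \<open>p\<close> decouples them at the price of a supremum over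
  \<open>p\<close>. The exchange of infimum and supremum is not taken from a minimax theorem; a
  saddle point is produced from a maximiser in \<open>p\<close>.

  The obstacle is that the conjugate may be infinite or nonsmooth, so it cannot be differentiated at
  the maximiser. The first-order condition comes instead from small moves towards a point where the
  conjugate is finite, and the limit needs a continuous gradient of the other term. This is why the
  squared distance of the speeds is kept in every lower bound: comparing the curves for two values
  of \<open>p\<close> with each other turns it into the Lipschitz estimate, and the same excess at
  an arbitrary time excludes a second optimal curve.\<close>

subsection \<open>Almost everywhere differentiability of Lipschitz functions\<close>

text \<open>Vitali argument: the intervals of slope at most \<open>r\<close> inside an open set
  slightly larger than \<open>E\<close> form a fine cover, so countably many disjoint ones exhaust
  \<open>E\<close> up to a null set. Each image interval is at most \<open>r\<close> times as long,
  and a Lipschitz map sends the leftover null set to a null set.\<close>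

lemma emeasure_image_le_of_small_slopes:
  fixes f :: "real \<Rightarrow> real"
  assumes mono: "strict_mono f" and lip: "L-lipschitz_on UNIV f" and r: "0 \<le> r"
    and E: "E \<in> sets lebesgue"
    and small: "\<And>x d. x \<in> E \<Longrightarrow> 0 < d \<Longrightarrow>
       \<exists>u v. u < x \<and> x < v \<and> v - u < d \<and> f v - f u \<le> r * (v - u)"
  shows "emeasure lebesgue (f ` E) \<le> ennreal r * emeasure lebesgue E"
proof -
  have "emeasure lebesgue (f ` E) \<le> ennreal r * emeasure lebesgue E + ennreal r * ennreal e"
    if "0 < e" for e
  proof -
    obtain G where G: "open G" "E \<subseteq> G" "G - E \<in> lmeasurable" "emeasure lebesgue (G - E) < ennreal e"
      using sets_lebesgue_outer_open[OF E \<open>0 < e\<close>] by blast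
    define K where "K = {(u, v). u < v \<and> {u..v} \<subseteq> G \<and> f v - f u \<le> r * (v - u)}"
    \<comment> \<open>The covering theorem speaks of closed balls, so an interval is encoded by its
      midpoint and half its length.\<close>
    define c where "c = (\<lambda>(u, v). (u + v) / 2 :: real)"
    define \<rho> where "\<rho> = (\<lambda>(u, v). (v - u) / 2 :: real)"
    have cb: "cball (c i) (\<rho> i) = {fst i..snd i}" if "i \<in> K" for i
      using that by (auto simp: K_def c_def \<rho>_def cball_eq_atLeastAtMost field_simps)
    have \<rho>: "0 < \<rho> i" if "i \<in> K" for i
      using that by (auto simp: K_def \<rho>_def)
    have cov: "\<exists>i. i \<in> K \<and> x \<in> cball (c i) (\<rho> i) \<and> \<rho> i < d" if x: "x \<in> E" "0 < d" for x d
    proof -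
      obtain h where h: "h > 0" "ball x h \<subseteq> G"
        using G x by (meson openE subsetD)
      obtain u v where uv: "u < x" "x < v" "v - u < min h d" "f v - f u \<le> r * (v - u)"
        using small[of x "min h d"] x h by auto
      have "{u..v} \<subseteq> ball x h"
        using uv by (auto simp: dist_real_def)
      then have "(u, v) \<in> K"
        using uv h by (auto simp: K_def)
      moreover have "x \<in> cball (c (u, v)) (\<rho> (u, v))"
        using uv cb[OF \<open>(u, v) \<in> K\<close>] by auto
      moreover have "\<rho> (u, v) < d"
        using uv by (auto simp: \<rho>_def)
      ultimately show ?thesis by blast
    qed
    obtain C where C: "countable C" "C \<subseteq> K"
      "pairwise (\<lambda>i j. disjnt (cball (c i) (\<rho> i)) (cball (c j) (\<rho> j))) C"
      "negligible (E - (\<Union>i\<in>C. cball (c i) (\<rho> i)))"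
      using Vitali_covering_theorem_cballs[of K \<rho> E c, OF \<rho> cov] by blast
    define N where "N = E - (\<Union>i\<in>C. cball (c i) (\<rho> i))"
    have cbC: "cball (c i) (\<rho> i) = {fst i..snd i}" if "i \<in> C" for i
      using C(2) cb that by blast
    have KC: "fst i < snd i" "{fst i..snd i} \<subseteq> G" "f (snd i) - f (fst i) \<le> r * (snd i - fst i)"
      if "i \<in> C" for i
      using subsetD[OF C(2) that] by (simp_all add: K_def case_prod_unfold)
    have "negligible (f ` N)"
    proof (rule negligible_locally_Lipschitz_image)
      show "negligible N" using C(4) by (simp add: N_def)
      show "\<exists>T B. open T \<and> x \<in> T \<and> (\<forall>y\<in>N \<inter> T. norm (f y - f x) \<le> B * norm (y - x))" for x
        by (rule exI[of _ UNIV], rule exI[of _ L])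
          (use lipschitz_onD[OF lip] in \<open>auto simp: dist_norm\<close>)
    qed simp
    then have N0: "f ` N \<in> null_sets lebesgue"
      by (simp add: negligible_iff_null_sets)
    have dis: "disjoint_family_on (\<lambda>i. {fst i..snd i}) C"
      using C(3) cbC unfolding disjoint_family_on_def pairwise_def disjnt_def by auto
    have disf: "disjoint_family_on (\<lambda>i. {f (fst i)..f (snd i)}) C"
      unfolding disjoint_family_on_def
    proof (intro ballI impI)
      fix i j assume ij: "i \<in> C" "j \<in> C" "i \<noteq> j"
      then have "{fst i..snd i} \<inter> {fst j..snd j} = {}"
        using dis by (auto simp: disjoint_family_on_def)
      then have "snd i < fst j \<or> snd j < fst i"
        using KC(1)[OF ij(1)] KC(1)[OF ij(2)]
        by (metis Int_iff atLeastAtMost_iff empty_iff less_le_not_le linorder_le_cases not_less order.strict_trans)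
      then show "{f (fst i)..f (snd i)} \<inter> {f (fst j)..f (snd j)} = {}"
        using mono by (auto simp: strict_mono_def) (smt (verit))+
    qed
    have "f ` E \<subseteq> f ` N \<union> (\<Union>i\<in>C. {f (fst i)..f (snd i)})"
    proof
      fix y assume "y \<in> f ` E"
      then obtain x where x: "x \<in> E" "y = f x" by blast
      show "y \<in> f ` N \<union> (\<Union>i\<in>C. {f (fst i)..f (snd i)})"
      proof (cases "x \<in> N")
        case False
        then obtain i where "i \<in> C" "x \<in> {fst i..snd i}"
          using x cbC by (auto simp: N_def)
        then show ?thesis
          using x mono by (auto simp: strict_mono_less_eq intro!: bexI[of _ i])
      qed (use x in auto)
    qed
    then have "emeasure lebesgue (f ` E) \<le> emeasure lebesgue (f ` N \<union> (\<Union>i\<in>C. {f (fst i)..f (snd i)}))"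
      using N0 C(1) by (intro emeasure_mono sets.Un sets.countable_UN') auto
    also have "\<dots> = emeasure lebesgue (\<Union>i\<in>C. {f (fst i)..f (snd i)})"
      by (subst Un_commute, rule emeasure_Un_null_set)
        (use N0 C(1) in \<open>auto intro!: sets.countable_UN'\<close>)
    also have "\<dots> = (\<integral>\<^sup>+i. emeasure lebesgue {f (fst i)..f (snd i)} \<partial>count_space C)"
      by (rule emeasure_UN_countable) (use C disf in auto)
    also have "\<dots> \<le> (\<integral>\<^sup>+i. ennreal r * emeasure lebesgue {fst i..snd i} \<partial>count_space C)"
    proof (rule nn_integral_mono)
      fix i assume "i \<in> space (count_space C)"
      then have i: "i \<in> C" by simp
      have "f (fst i) < f (snd i)" using KC(1)[OF i] mono by (simp add: strict_mono_def)
      then show "emeasure lebesgue {f (fst i)..f (snd i)} \<le> ennreal r * emeasure lebesgue {fst i..snd i}"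
        using KC[OF i] r by (simp add: ennreal_mult[symmetric] ennreal_leI)
    qed
    also have "\<dots> = ennreal r * (\<integral>\<^sup>+i. emeasure lebesgue {fst i..snd i} \<partial>count_space C)"
      by (rule nn_integral_cmult) auto
    also have "(\<integral>\<^sup>+i. emeasure lebesgue {fst i..snd i} \<partial>count_space C) = emeasure lebesgue (\<Union>i\<in>C. {fst i..snd i})"
      by (rule emeasure_UN_countable[symmetric]) (use C dis in auto)
    also have "emeasure lebesgue (\<Union>i\<in>C. {fst i..snd i}) \<le> emeasure lebesgue G"
      by (intro emeasure_mono UN_least KC(2)) (use G(1) in auto)
    also have "emeasure lebesgue G = emeasure lebesgue (E \<union> (G - E))"
      using G by (simp add: Un_absorb1)
    also have "\<dots> = emeasure lebesgue E + emeasure lebesgue (G - E)"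
      by (rule plus_emeasure[symmetric]) (use E G in auto)
    also have "\<dots> \<le> emeasure lebesgue E + ennreal e"
      using G(4) by (simp add: add_left_mono less_imp_le)
    finally show ?thesis
      by (simp add: distrib_left mult_left_mono)
  qed
  note * = this
  show ?thesis
  proof (rule ennreal_le_epsilon)
    fix e :: real assume "0 < e"
    \<comment> \<open>The divisor \<open>r + 1\<close> stays positive for \<open>r = 0\<close>, and
      \<open>r / (r + 1)\<close> is at most 1.\<close>
    then have "ennreal r * ennreal (e / (r + 1)) \<le> ennreal e"
      using r by (simp add: ennreal_mult[symmetric] field_simps ennreal_leI)
    then show "emeasure lebesgue (f ` E) \<le> ennreal r * emeasure lebesgue E + ennreal e"
      using *[of "e / (r + 1)"] \<open>0 < e\<close> r
      by (smt (verit) add_left_mono divide_pos_pos order_trans)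
  qed
qed

text \<open>Where the difference quotients have no limit, two rationals \<open>r < s\<close>
  separate their lower and upper limits. On the set of such points a monotone modification of
  \<open>g\<close> multiplies measure by at most \<open>r\<close> and its inverse by at most
  \<open>1 / s\<close>, so a set of finite measure is bounded by \<open>r / s < 1\<close> times its
  own measure.\<close>

lemma lipschitz_negligible_nondifferentiable:
  fixes g :: "real \<Rightarrow> real"
  assumes lip: "L-lipschitz_on UNIV g"
  shows "negligible {x. \<not> g differentiable (at x)}"
proof -
  have L: "0 \<le> L" using lip by (rule lipschitz_on_nonneg)
  \<comment> \<open>Adding a linear term does not affect differentiability, and \<open>L + 1\<close>
    makes all slopes lie between 1 and \<open>2 * L + 1\<close>, so that \<open>f\<close> and its
    inverse are both increasing and Lipschitz.\<close>
  define f where "f = (\<lambda>x. g x + (L + 1) * x)"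
  have g_le: "\<bar>g y - g x\<bar> \<le> L * \<bar>y - x\<bar>" for x y
    using lipschitz_onD[OF lip, of y x] by (simp add: dist_real_def)
  have f_lo: "y - x \<le> f y - f x" and f_up: "f y - f x \<le> (2 * L + 1) * (y - x)" if "x \<le> y" for x y
    using g_le[of y x] that by (auto simp: f_def algebra_simps abs_le_iff)
  have mono: "strict_mono f"
    using f_lo by (smt (verit) strict_monoI)
  then have inj: "inj f" by (rule strict_mono_imp_inj_on)
  have f_lip: "(2 * L + 1)-lipschitz_on UNIV f"
  proof (rule lipschitz_onI)
    fix x y :: real
    show "dist (f x) (f y) \<le> (2 * L + 1) * dist x y"
      using f_lo[of x y] f_up[of x y] f_lo[of y x] f_up[of y x] by (cases "x \<le> y") (auto simp: dist_real_def)
  qed (use L in simp)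
  have f_cont: "continuous_on UNIV f"
    using f_lip by (rule lipschitz_on_continuous_on)
  have "surj f"
    unfolding surj_def
  proof
    fix y
    define R where "R = \<bar>y\<bar> + \<bar>f 0\<bar>"
    have R: "0 \<le> R" "\<bar>y\<bar> \<le> R - \<bar>f 0\<bar>" by (auto simp: R_def)
    then have "f (- R) \<le> y" "y \<le> f R"
      using f_lo[of "-R" 0] f_lo[of 0 R] by auto
    then show "\<exists>x. y = f x"
      using IVT'[of f "-R" y R] f_cont R(1) by (metis continuous_on_subset subset_UNIV neg_le_0_iff_le order_trans)
  qed
  define h where "h = inv f"
  have hf: "h (f x) = x" and fh: "f (h y) = y" for x y
    using inj \<open>surj f\<close> by (auto simp: h_def surj_f_inv_f)
  have h_mono: "strict_mono h"
    using mono by (metis fh strict_monoI strict_mono_less)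
  have h_lip: "1-lipschitz_on UNIV h"
  proof (rule lipschitz_onI)
    fix x y :: real
    show "dist (h x) (h y) \<le> 1 * dist x y"
      using f_lo[of "h x" "h y"] f_lo[of "h y" "h x"] fh by (cases "h x \<le> h y") (auto simp: dist_real_def)
  qed simp
  have h_cont: "continuous_on UNIV h"
    using h_lip by (rule lipschitz_on_continuous_on)
  text \<open>Asking for slopes of intervals around \<open>x\<close>, not of intervals ending at \<open>x\<close>, makes the exceptional
    sets countable intersections of open sets.\<close>
  define A where "A r n = \<Union>{{u<..<v} | u v. v - u < 1 / Suc n \<and> f v - f u < r * (v - u)}" for r n
  define B where "B s n = \<Union>{{u<..<v} | u v. v - u < 1 / Suc n \<and> s * (v - u) < f v - f u}" for s n
  define E where "E r s k = (\<Inter>n. A r n) \<inter> (\<Inter>n. B s n) \<inter> {- real k..real k}" for r s k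
  have E_neg: "negligible (E r s k)" if rs: "0 < r" "r < s" for r s k
  proof -
    have "open (A r n)" "open (B s n)" for n
      unfolding A_def B_def by (auto intro!: open_Union)
    then have E_borel: "E r s k \<in> sets borel"
      unfolding E_def by (intro sets.Int sets.countable_INT') auto
    have fE_borel: "f ` E r s k \<in> sets borel"
    proof -
      have "f ` E r s k = h -` E r s k \<inter> space borel"
        using hf by auto (metis fh imageI)
      also have "\<dots> \<in> sets borel"
        using borel_measurable_continuous_onI[OF h_cont] E_borel by (rule measurable_sets)
      finally show ?thesis .
    qed
    have 1: "emeasure lebesgue (f ` E r s k) \<le> ennreal r * emeasure lebesgue (E r s k)"
    proof (rule emeasure_image_le_of_small_slopes[OF mono f_lip])
      fix x d :: real assume x: "x \<in> E r s k" "0 < d"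
      obtain n where n: "1 / real (Suc n) < d"
        using x(2) by (metis nat_approx_posE)
      have "x \<in> A r n" using x by (simp add: E_def)
      then show "\<exists>u v. u < x \<and> x < v \<and> v - u < d \<and> f v - f u \<le> r * (v - u)"
        using n by (force simp: A_def intro: less_imp_le)
    qed (use E_borel rs in \<open>auto intro: sets_completionI_sets\<close>)
    have "emeasure lebesgue (h ` (f ` E r s k)) \<le> ennreal (1 / s) * emeasure lebesgue (f ` E r s k)"
    proof (rule emeasure_image_le_of_small_slopes[OF h_mono h_lip])
      fix y d :: real assume y: "y \<in> f ` E r s k" "0 < d"
      then obtain x where x: "x \<in> E r s k" "y = f x" by blast
      \<comment> \<open>The interval used for \<open>h\<close> runs from \<open>f u\<close> to
        \<open>f v\<close> and can be \<open>2 * L + 1\<close> times as long as the one from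
        \<open>u\<close> to \<open>v\<close>.\<close>
      obtain n where n: "1 / real (Suc n) < d / (2 * L + 1)"
        using y(2) L by (metis nat_approx_posE add_nonneg_pos divide_pos_pos mult_nonneg_nonneg zero_le_numeral zero_less_one)
      have "x \<in> B s n" using x by (simp add: E_def)
      then obtain u v where uv: "u < x" "x < v" "v - u < 1 / Suc n" "s * (v - u) < f v - f u"
        by (auto simp: B_def)
      have "f v - f u \<le> (2 * L + 1) * (v - u)" using f_up[of u v] uv by simp
      also have "\<dots> < (2 * L + 1) * (d / (2 * L + 1))"
        using uv n L by (intro mult_strict_left_mono) auto
      also have "\<dots> = d" using L by simp
      finally have "f v - f u < d" .
      moreover have "f u < y" "y < f v" using uv x mono by (auto simp: strict_mono_def)
      moreover have "h (f v) - h (f u) \<le> 1 / s * (f v - f u)"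
        using uv rs by (simp add: hf field_simps)
      ultimately show "\<exists>u v. u < y \<and> y < v \<and> v - u < d \<and> h v - h u \<le> 1 / s * (v - u)"
        by blast
    qed (use fE_borel rs in \<open>auto intro: sets_completionI_sets\<close>)
    also have "h ` (f ` E r s k) = E r s k"
      by (simp add: image_image hf)
    also have "ennreal (1 / s) * emeasure lebesgue (f ` E r s k)
        \<le> ennreal (1 / s) * (ennreal r * emeasure lebesgue (E r s k))"
      using 1 by (rule mult_left_mono) simp
    finally have 2: "emeasure lebesgue (E r s k) \<le> ennreal (r / s) * emeasure lebesgue (E r s k)"
      using rs by (simp add: mult.assoc[symmetric] ennreal_mult[symmetric])
    \<comment> \<open>The cutoff at \<open>k\<close> makes the measure finite, which is what lets
      \<open>m \<le> r / s * m\<close> force \<open>m = 0\<close>.\<close>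
    have "emeasure lebesgue (E r s k) \<le> emeasure lebesgue {- real k..real k}"
      by (rule emeasure_mono) (auto simp: E_def)
    also have "\<dots> < \<infinity>" by simp
    finally obtain m where m: "0 \<le> m" "emeasure lebesgue (E r s k) = ennreal m"
      by (metis ennreal_cases infinity_ennreal_def less_irrefl)
    then have "m \<le> r / s * m"
      using 2 rs by (simp add: ennreal_mult[symmetric])
    then have "m * (s - r) \<le> 0"
      using rs by (simp add: field_simps)
    then have "m = 0"
      using m(1) rs by (metis diff_gt_0_iff_gt mult_le_0_iff not_less order_antisym)
    then show ?thesis
      using m E_borel by (simp add: negligible_iff_null_sets null_sets_def sets_completionI_sets)
  qed
  define N where "N = (\<Union>(r, s, k) \<in> {(r, s, k). r \<in> \<rat> \<and> s \<in> \<rat> \<and> 0 < r \<and> r < s}. E r s k)"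
  have "negligible N"
    unfolding N_def
  proof (rule negligible_countable_Union)
    have "countable (\<rat> \<times> \<rat> \<times> (UNIV :: nat set))"
      by (intro countable_SIGMA countable_rat) auto
    then show "countable ((\<lambda>(r, s, k). E r s k) ` {(r, s, k). r \<in> \<rat> \<and> s \<in> \<rat> \<and> 0 < r \<and> r < s})"
      by (rule countable_image[OF countable_subset, rotated]) auto
  qed (use E_neg in auto)
  moreover have "{x. \<not> g differentiable (at x)} \<subseteq> N"
  proof
    fix x assume nd: "x \<in> {x. \<not> g differentiable (at x)}"
    define q where "q y = (f y - f x) / (y - x)" for y
    have q_bounds: "1 \<le> q y" "q y \<le> 2 * L + 1" if "y \<noteq> x" for y
      using f_lo[of x y] f_lo[of y x] f_up[of x y] f_up[of y x] that
      by (cases "x < y"; simp add: q_def field_simps)+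
    have "Liminf (at x) (\<lambda>y. ereal (q y)) < Limsup (at x) (\<lambda>y. ereal (q y))"
    proof (rule ccontr)
      assume "\<not> ?thesis"
      then have "Liminf (at x) (\<lambda>y. ereal (q y)) = Limsup (at x) (\<lambda>y. ereal (q y))"
        using Liminf_le_Limsup[of "at x" "\<lambda>y. ereal (q y)"] by (simp add: order.antisym)
      then obtain l where l: "((\<lambda>y. ereal (q y)) \<longlongrightarrow> l) (at x)"
        using tendsto_iff_Liminf_eq_Limsup[of "at x" "\<lambda>y. ereal (q y)"] by auto
      have "ereal 1 \<le> l" "l \<le> ereal (2 * L + 1)"
        using q_bounds
        by (auto intro!: tendsto_lowerbound[OF l] tendsto_upperbound[OF l] simp: eventually_at_filter)
      then obtain D where "l = ereal D"
        by (cases l) auto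
      then have "(q \<longlongrightarrow> D) (at x)" using l by simp
      then have "(f has_field_derivative D) (at x)"
        by (simp add: has_field_derivative_iff q_def[abs_def])
      then have "((\<lambda>y. f y - (L + 1) * y) has_field_derivative D - (L + 1)) (at x)"
        by (auto intro!: derivative_eq_intros)
      then show False
        using nd by (auto simp: f_def real_differentiable_def)
    qed
    then obtain m where m: "Liminf (at x) (\<lambda>y. ereal (q y)) < ereal m" "ereal m < Limsup (at x) (\<lambda>y. ereal (q y))"
      using ereal_dense2 by blast
    then obtain m' where m': "ereal m < ereal m'" "ereal m' < Limsup (at x) (\<lambda>y. ereal (q y))"
      using ereal_dense2 by blast
    \<comment> \<open>Slopes of \<open>f\<close> are at least 1, hence the rational \<open>r\<close>
      chosen above \<open>m\<close> is positive, as \<open>E_neg\<close> demands.\<close>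
    have "ereal 1 \<le> Liminf (at x) (\<lambda>y. ereal (q y))"
      using q_bounds by (intro Liminf_bounded) (auto simp: eventually_at_filter)
    then have "1 < m" using m(1) by (metis ereal_less_eq(3) less_le_not_le not_le order.strict_trans1)
    obtain r where r: "r \<in> \<rat>" "m < r" "r < m'"
      using Rats_dense_in_real[of m m'] m' by auto
    obtain s where s: "s \<in> \<rat>" "r < s" "s < m'"
      using Rats_dense_in_real[of r m'] r by auto
    have q_lt: "\<exists>y. y \<noteq> x \<and> \<bar>y - x\<bar> < d \<and> q y < r" if "0 < d" for d
    proof (rule ccontr)
      assume "\<not> ?thesis"
      then have "eventually (\<lambda>y. ereal r \<le> ereal (q y)) (at x)"
        using that unfolding eventually_at by (auto simp: dist_real_def not_less intro!: exI[of _ d])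
      then have "ereal r \<le> Liminf (at x) (\<lambda>y. ereal (q y))"
        by (rule Liminf_bounded)
      then show False using m(1) r(2) by (metis ereal_less(2) ereal_less_eq(3) less_le_not_le order.trans order.strict_trans1 less_ereal.simps(1))
    qed
    have q_gt: "\<exists>y. y \<noteq> x \<and> \<bar>y - x\<bar> < d \<and> s < q y" if "0 < d" for d
    proof (rule ccontr)
      assume "\<not> ?thesis"
      then have "eventually (\<lambda>y. ereal (q y) \<le> ereal s) (at x)"
        using that unfolding eventually_at by (auto simp: dist_real_def not_less intro!: exI[of _ d])
      then have "Limsup (at x) (\<lambda>y. ereal (q y)) \<le> ereal s"
        by (rule Limsup_bounded)
      then show False using m'(2) s(3) by (metis less_ereal.simps(1) not_le order.strict_trans)
    qed
    \<comment> \<open>A difference quotient at \<open>x\<close> belongs to an interval ending at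
      \<open>x\<close>. The inequality is strict and \<open>f\<close> continuous, so that endpoint
      can be pushed a little past \<open>x\<close>. The sign \<open>c\<close> serves small slopes
      (\<open>c = 1\<close>) and large slopes (\<open>c = -1\<close>) at once.\<close>
    have enlarge: "\<exists>u v. u < x \<and> x < v \<and> v - u < d \<and> c * (f v - f u - \<sigma> * (v - u)) < 0"
      if y: "y \<noteq> x" "\<bar>y - x\<bar> < d" and neg: "c * ((q y - \<sigma>) * \<bar>y - x\<bar>) < 0" for y d c \<sigma>
    proof -
      have q_mult: "q y * (y - x) = f y - f x" using y(1) by (simp add: q_def)
      show ?thesis
      proof (cases "x < y")
        case True
        let ?k = "\<lambda>u. c * (f y - f u - \<sigma> * (y - u))"
        have "isCont ?k x"
          using f_cont by (intro continuous_intros) (simp_all add: continuous_on_eq_continuous_at)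
        moreover have "?k x < 0"
          using neg True q_mult by (simp add: left_diff_distrib)
        ultimately have "eventually (\<lambda>u. ?k u < 0) (at x)"
          unfolding isCont_def by (rule order_tendstoD)
        then obtain e where e: "0 < e" "\<And>u. u \<noteq> x \<Longrightarrow> dist u x < e \<Longrightarrow> ?k u < 0"
          unfolding eventually_at by auto
        define m where "m = min e (d - (y - x))"
        have m: "0 < m" "m \<le> e" "m \<le> d - (y - x)"
          using e(1) y True by (auto simp: m_def)
        define u where "u = x - m / 2"
        have "u < x" "dist u x < e" "y - u < d"
          using m by (simp_all add: u_def dist_real_def)
        then show ?thesis using e(2)[of u] True by (intro exI[of _ u] exI[of _ y]) auto
      next
        case False
        let ?k = "\<lambda>v. c * (f v - f y - \<sigma> * (v - y))"
        have "isCont ?k x"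
          using f_cont by (intro continuous_intros) (simp_all add: continuous_on_eq_continuous_at)
        moreover have "?k x < 0"
        proof -
          have "\<bar>y - x\<bar> = x - y" "q y * (x - y) = f x - f y"
            using False q_mult by (simp_all add: algebra_simps)
          then show ?thesis using neg by (simp add: left_diff_distrib)
        qed
        ultimately have "eventually (\<lambda>u. ?k u < 0) (at x)"
          unfolding isCont_def by (rule order_tendstoD)
        then obtain e where e: "0 < e" "\<And>u. u \<noteq> x \<Longrightarrow> dist u x < e \<Longrightarrow> ?k u < 0"
          unfolding eventually_at by auto
        define m where "m = min e (d - (x - y))"
        have m: "0 < m" "m \<le> e" "m \<le> d - (x - y)"
          using e(1) y False by (auto simp: m_def)
        define v where "v = x + m / 2"
        have "x < v" "dist v x < e" "v - y < d"
          using m by (simp_all add: v_def dist_real_def)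
        then show ?thesis using e(2)[of v] False y by (intro exI[of _ y] exI[of _ v]) auto
      qed
    qed
    have "x \<in> A r n" for n
    proof -
      obtain y where y: "y \<noteq> x" "\<bar>y - x\<bar> < 1 / Suc n" "q y < r"
        using q_lt[of "1 / Suc n"] by auto
      then have "1 * ((q y - r) * \<bar>y - x\<bar>) < 0" by (simp add: mult_less_0_iff)
      from enlarge[OF y(1,2) this] show ?thesis
        unfolding A_def by force
    qed
    moreover have "x \<in> B s n" for n
    proof -
      obtain y where y: "y \<noteq> x" "\<bar>y - x\<bar> < 1 / Suc n" "s < q y"
        using q_gt[of "1 / Suc n"] by auto
      then have "(-1) * ((q y - s) * \<bar>y - x\<bar>) < 0" by (simp add: mult_less_0_iff)
      from enlarge[OF y(1,2) this] show ?thesis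
        unfolding B_def by force
    qed
    moreover obtain k :: nat where "\<bar>x\<bar> \<le> real k"
      using real_arch_simple by blast
    ultimately have "x \<in> E r s k"
      by (auto simp: E_def)
    then show "x \<in> N"
      using r s \<open>1 < m\<close> unfolding N_def by (intro UN_I[of "(r, s, k)"]) auto
  qed
  ultimately show ?thesis by (rule negligible_subset)
qed

section \<open>Derivatives of Lipschitz functions on an interval and their integrals\<close>

lemma lipschitz_AE_has_vector_derivative:
  fixes f :: "real \<Rightarrow> real"
  assumes lip: "L-lipschitz_on {a..b} f" and ab: "a < b"
  obtains N where "negligible N"
    "\<And>s. s \<in> {a..b} - N \<Longrightarrow> a < s \<and> s < b"
    "\<And>s. s \<in> {a..b} - N \<Longrightarrow>
       (f has_real_derivative vector_derivative f (at s within {a..b})) (at s)"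
    "\<And>s. s \<in> {a..b} - N \<Longrightarrow> \<bar>vector_derivative f (at s within {a..b})\<bar> \<le> L"
proof -
  \<comment> \<open>Clamping the argument extends \<open>f\<close> to the whole line with the same
    Lipschitz constant. The extension may have kinks at \<open>a\<close> and \<open>b\<close>, which
    are therefore put into the exceptional set.\<close>
  define F where "F = (\<lambda>x. f (max a (min b x)))"
  have F_lip: "L-lipschitz_on UNIV F"
  proof (rule lipschitz_onI)
    show "0 \<le> L" using lip by (rule lipschitz_on_nonneg)
    fix x y :: real
    have "dist (F x) (F y) \<le> L * dist (max a (min b x)) (max a (min b y))"
      unfolding F_def using ab by (intro lipschitz_onD[OF lip]) auto
    also have "\<dots> \<le> L * dist x y"
      using \<open>0 \<le> L\<close> by (intro mult_left_mono) (auto simp: dist_real_def)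
    finally show "dist (F x) (F y) \<le> L * dist x y" .
  qed
  define N where "N = {x. \<not> F differentiable (at x)} \<union> {a, b}"
  have deriv: "(f has_real_derivative vector_derivative f (at s within {a..b})) (at s)
      \<and> \<bar>vector_derivative f (at s within {a..b})\<bar> \<le> L"
    if s: "s \<in> {a..b} - N" for s
  proof -
    have int: "s \<in> {a<..<b}" using s by (auto simp: N_def)
    obtain D where D: "(F has_real_derivative D) (at s)"
      using s by (auto simp: N_def real_differentiable_def)
    then have "(F has_vector_derivative D) (at s)"
      by (simp add: has_real_derivative_iff_has_vector_derivative)
    then have f: "(f has_vector_derivative D) (at s)"
      by (rule has_vector_derivative_transform_within_open[OF _ _ int]) (auto simp: F_def)
    then have eq: "vector_derivative f (at s within {a..b}) = D"
      using int ab by (intro vector_derivative_within_cbox[of a b, simplified])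
        (auto intro: has_vector_derivative_at_within)
    have "\<bar>D\<bar> \<le> L"
    proof (rule tendsto_upperbound)
      show "((\<lambda>y. \<bar>(F y - F s) / (y - s)\<bar>) \<longlongrightarrow> \<bar>D\<bar>) (at s)"
        using D by (intro tendsto_rabs) (simp add: has_field_derivative_iff)
      show "\<forall>\<^sub>F y in at s. \<bar>(F y - F s) / (y - s)\<bar> \<le> L"
        using lipschitz_onD[OF F_lip]
        by (auto simp: eventually_at_filter dist_real_def abs_divide divide_le_eq)
    qed simp
    then show ?thesis
      using f eq by (simp add: has_real_derivative_iff_has_vector_derivative)
  qed
  show ?thesis
  proof
    show "negligible N"
      unfolding N_def using lipschitz_negligible_nondifferentiable[OF F_lip] by simp
  qed (use deriv in \<open>auto simp: N_def\<close>)
qed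

text \<open>Difference quotients with step \<open>h n\<close> converge almost everywhere to the
  derivative and are bounded by \<open>L\<close>, so dominated convergence applies. Their integrals
  are explicit: with an antiderivative \<Psi> of the function they become difference quotients of
  \<Psi> at the two endpoints.\<close>

lemma lipschitz_has_integral_vector_derivative:
  fixes f :: "real \<Rightarrow> real"
  assumes lip: "L-lipschitz_on {a..b} f" and ab: "a < b"
  shows "((\<lambda>s. vector_derivative f (at s within {a..b})) has_integral f b - f a) {a..b}"
proof -
  define D where "D = (\<lambda>s. vector_derivative f (at s within {a..b}))"
  obtain N where N: "negligible N" "\<And>s. s \<in> {a..b} - N \<Longrightarrow> a < s \<and> s < b"
    "\<And>s. s \<in> {a..b} - N \<Longrightarrow> (f has_real_derivative D s) (at s)"
    unfolding D_def using lipschitz_AE_has_vector_derivative[OF lip ab] by metis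
  define F where "F = (\<lambda>x. f (max a (min b x)))"
  have L: "0 \<le> L" using lip by (rule lipschitz_on_nonneg)
  have F_lip: "\<bar>F x - F y\<bar> \<le> L * \<bar>x - y\<bar>" for x y
  proof -
    have "\<bar>F x - F y\<bar> \<le> L * \<bar>max a (min b x) - max a (min b y)\<bar>"
      unfolding F_def using ab lipschitz_onD[OF lip, of "max a (min b x)" "max a (min b y)"]
      by (auto simp: dist_real_def)
    also have "\<dots> \<le> L * \<bar>x - y\<bar>"
      using L by (intro mult_left_mono) auto
    finally show ?thesis .
  qed
  have "L-lipschitz_on UNIV F"
    using F_lip L by (auto intro!: lipschitz_onI simp: dist_real_def)
  then have F_cont: "continuous_on A F" for A
    using continuous_on_subset lipschitz_on_continuous_on by blast
  \<comment> \<open>The margin makes \<Psi> differentiable from both sides at every point of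
    \<open>{a..b + 1}\<close>, which contains all shifted points \<open>s + h n\<close>.\<close>
  obtain \<Psi> where \<Psi>: "\<And>x. x \<in> {a - 1..b + 2} \<Longrightarrow> (\<Psi> has_vector_derivative F x) (at x within {a - 1..b + 2})"
    using antiderivative_continuous[OF F_cont[of "{a - 1..b + 2}"]] by blast
  have \<Psi>_at: "(\<Psi> has_real_derivative F x) (at x)" if "x \<in> {a..b + 1}" for x
  proof -
    have "x \<in> interior {a - 1..b + 2}" using that by simp
    then have "at x within {a - 1..b + 2} = at x" by (rule at_within_interior)
    then show ?thesis
      using \<Psi>[of x] that by (simp add: has_real_derivative_iff_has_vector_derivative)
  qed
  define h where "h n = 1 / real (Suc n)" for n
  have h: "0 < h n" "h n \<le> 1" for n by (auto simp: h_def)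
  have h0: "h \<longlonglongrightarrow> 0" unfolding h_def by (rule LIMSEQ_Suc[OF lim_1_over_n])
  have h_at: "filterlim h (at 0) sequentially"
    using h h0 by (auto simp: filterlim_at intro!: always_eventually less_imp_neq[THEN not_sym])
  define q where "q n s = (F (s + h n) - F s) / h n" for n s
  define I where "I n = (\<Psi> (b + h n) - \<Psi> b) / h n - (\<Psi> (a + h n) - \<Psi> a) / h n" for n
  have q_int: "(q n has_integral I n) {a..b}" for n
  proof -
    have "((\<lambda>s. F (s + h n) - F s) has_integral
        (\<Psi> (b + h n) - \<Psi> b) - (\<Psi> (a + h n) - \<Psi> a)) {a..b}"
    proof (rule fundamental_theorem_of_calculus)
      fix s assume s: "s \<in> {a..b}"
      have "((\<lambda>s. \<Psi> (s + h n) - \<Psi> s) has_real_derivative F (s + h n) - F s) (at s)"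
        using \<Psi>_at[of s] \<Psi>_at[of "s + h n"] s h[of n]
        by (intro DERIV_diff) (auto simp: DERIV_shift)
      then show "((\<lambda>s. \<Psi> (s + h n) - \<Psi> s) has_vector_derivative F (s + h n) - F s) (at s within {a..b})"
        by (simp add: has_real_derivative_iff_has_vector_derivative has_vector_derivative_at_within)
    qed (use ab in simp)
    from has_integral_divide[OF this, of "h n"] show ?thesis
      by (simp add: q_def[abs_def] I_def diff_divide_distrib)
  qed
  have quot: "(\<lambda>n. (G (c + h n) - G c) / h n) \<longlonglongrightarrow> G'" if "(G has_real_derivative G') (at c)" for G c G'
    using filterlim_compose[OF that[unfolded DERIV_def] h_at] .
  have "I \<longlonglongrightarrow> F b - F a"
    unfolding I_def using ab by (intro tendsto_diff quot \<Psi>_at) auto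
  then have I_lim: "I \<longlonglongrightarrow> f b - f a"
    using ab by (simp add: F_def)
  have lim: "(\<lambda>n. q n s) \<longlonglongrightarrow> D s" if s: "s \<in> {a..b} - N" for s
  proof -
    have "(F has_real_derivative D s) (at s)"
      using N(3)[OF s] N(2)[OF s] unfolding has_real_derivative_iff_has_vector_derivative
      by (elim has_vector_derivative_transform_within_open[of _ _ _ "{a<..<b}"]) (auto simp: F_def)
    then show ?thesis unfolding q_def by (rule quot)
  qed
  have q_int': "q n integrable_on {a..b} - N" for n
    by (rule integrable_spike_set[OF has_integral_integrable[OF q_int]])
      (auto intro: negligible_subset[OF N(1)])
  have bound: "norm (q n s) \<le> L" for n s
    using F_lip[of "s + h n" s] h(1)[of n] by (simp add: q_def abs_divide divide_le_eq)
  have L_int: "(\<lambda>s. L) integrable_on {a..b} - N"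
    by (rule integrable_spike_set[of _ "{a..b}"]) (auto intro: negligible_subset[OF N(1)])
  have D_int: "D integrable_on {a..b} - N"
    and D_lim: "(\<lambda>n. integral ({a..b} - N) (q n)) \<longlonglongrightarrow> integral ({a..b} - N) D"
    using dominated_convergence[OF q_int' L_int bound lim] by auto
  have "integral ({a..b} - N) (q n) = I n" for n
    by (subst integral_unique[OF q_int[of n], symmetric], rule integral_spike_set)
      (auto intro: negligible_subset[OF N(1)])
  then have "integral ({a..b} - N) D = f b - f a"
    using D_lim I_lim LIMSEQ_unique by simp
  then have "(D has_integral f b - f a) ({a..b} - N)"
    using D_int by (simp add: has_integral_integrable_integral)
  then show ?thesis
    unfolding D_def[symmetric]
    by (rule iffD1[OF has_integral_spike_set_eq, rotated 2]) (auto intro: negligible_subset[OF N(1)])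
qed

lemma lipschitz_lebesgue_vector_derivative:
  fixes f :: "real \<Rightarrow> real"
  assumes lip: "L-lipschitz_on {a..b} f" and ab: "a < b"
  defines "f' \<equiv> \<lambda>s. vector_derivative f (at s within {a..b})"
  shows "AE s in lebesgue_on {a..b}. a < s \<and> s < b \<and> (f has_real_derivative f' s) (at s) \<and> \<bar>f' s\<bar> \<le> L"
    and "f' \<in> borel_measurable (lebesgue_on {a..b})"
    and "integrable (lebesgue_on {a..b}) f'"
    and "(\<integral>s. f' s \<partial>lebesgue_on {a..b}) = f b - f a"
proof -
  obtain N where N: "negligible N" "\<And>s. s \<in> {a..b} - N \<Longrightarrow> a < s \<and> s < b"
    "\<And>s. s \<in> {a..b} - N \<Longrightarrow> (f has_real_derivative f' s) (at s)"
    "\<And>s. s \<in> {a..b} - N \<Longrightarrow> \<bar>f' s\<bar> \<le> L"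
    unfolding f'_def using lipschitz_AE_has_vector_derivative[OF lip ab] by metis
  have "AE s in lebesgue. s \<notin> N"
    using N(1) by (simp add: negligible_iff_null_sets AE_not_in)
  then show ae: "AE s in lebesgue_on {a..b}. a < s \<and> s < b \<and> (f has_real_derivative f' s) (at s) \<and> \<bar>f' s\<bar> \<le> L"
    using N by (auto simp: AE_restrict_space_iff elim!: eventually_mono)
  have I: "(f' has_integral f b - f a) {a..b}"
    unfolding f'_def by (rule lipschitz_has_integral_vector_derivative[OF lip ab])
  then show meas: "f' \<in> borel_measurable (lebesgue_on {a..b})"
    by (intro integrable_imp_measurable) auto
  interpret finite_measure "lebesgue_on {a..b}"
    by (rule finite_measure_lebesgue_on) simp
  show int: "integrable (lebesgue_on {a..b}) f'"
    using ae by (intro integrable_const_bound[of _ L] meas) (auto elim: eventually_mono)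
  show "(\<integral>s. f' s \<partial>lebesgue_on {a..b}) = f b - f a"
    using I int by (simp add: lebesgue_integral_eq_integral integral_unique)
qed

lemma vector_derivative_within_interval_eq:
  fixes f :: "real \<Rightarrow> real"
  assumes "(f has_real_derivative D) (at s within {a..b})" "a < b" "s \<in> {a..b}"
  shows "vector_derivative f (at s within {a..b}) = D"
  using assms by (intro vector_derivative_within_cbox[of a b, simplified])
    (auto simp: has_real_derivative_iff_has_vector_derivative)

lemma lipschitz_on_real_mult:
  fixes f g :: "real \<Rightarrow> real"
  assumes f: "L-lipschitz_on S f" and g: "K-lipschitz_on S g"
    and "\<And>x. x \<in> S \<Longrightarrow> \<bar>f x\<bar> \<le> A" "\<And>x. x \<in> S \<Longrightarrow> \<bar>g x\<bar> \<le> B" and AB: "0 \<le> A" "0 \<le> B"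
  shows "(A * K + B * L)-lipschitz_on S (\<lambda>x. f x * g x)"
proof (rule lipschitz_onI)
  show "0 \<le> A * K + B * L"
    using AB lipschitz_on_nonneg[OF f] lipschitz_on_nonneg[OF g] by simp
  fix x y assume xy: "x \<in> S" "y \<in> S"
  have "f x * g x - f y * g y = f x * (g x - g y) + g y * (f x - f y)"
    by (simp add: algebra_simps)
  then have "\<bar>f x * g x - f y * g y\<bar> \<le> \<bar>f x\<bar> * \<bar>g x - g y\<bar> + \<bar>g y\<bar> * \<bar>f x - f y\<bar>"
    by (metis abs_mult abs_triangle_ineq)
  also have "\<dots> \<le> A * (K * dist x y) + B * (L * dist x y)"
    using assms xy lipschitz_onD[OF f xy] lipschitz_onD[OF g xy]
    by (intro add_mono mult_mono) (auto simp: dist_real_def)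
  finally show "dist (f x * g x) (f y * g y) \<le> (A * K + B * L) * dist x y"
    by (simp add: dist_real_def algebra_simps)
qed

lemma lipschitz_on_interval_bounded:
  fixes f :: "real \<Rightarrow> real"
  assumes "L-lipschitz_on {a..b} f"
  obtains B where "0 \<le> B" "\<And>x. x \<in> {a..b} \<Longrightarrow> \<bar>f x\<bar> \<le> B"
proof -
  have "bounded (f ` {a..b})"
    using assms by (intro compact_imp_bounded compact_continuous_image lipschitz_on_continuous_on) auto
  then obtain B where "\<forall>x\<in>{a..b}. \<bar>f x\<bar> \<le> B"
    by (auto simp: bounded_iff)
  then show ?thesis by (intro that[of "\<bar>B\<bar>"]) force+
qed

subsection \<open>The scalar variational problem\<close>

definition potential :: "real \<Rightarrow> real \<Rightarrow> real \<Rightarrow> real" where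
  "potential a b z = (if z \<ge> 0 then a * z else - b * z)"

definition speed :: "real \<Rightarrow> (real \<Rightarrow> real) \<Rightarrow> real \<Rightarrow> real" where
  "speed t y s = vector_derivative y (at s within {0..t})"

definition running_cost :: "real \<Rightarrow> real \<Rightarrow> real \<Rightarrow> (real \<Rightarrow> real) \<Rightarrow> real" where
  "running_cost a b t y = (\<integral>s. 1 / 2 * (speed t y s)\<^sup>2 + potential a b (y s) \<partial>lebesgue_on {0..t})"

text \<open>The Euler--Lagrange inclusion: \<open>w s\<close> is a subgradient of the potential at \<open>g s\<close>. The potential is
  the support function of \<open>{-b..a}\<close>, which turns the inclusion into the last two conditions.\<close>

definition extremal :: "real \<Rightarrow> real \<Rightarrow> real \<Rightarrow> (real \<Rightarrow> real) \<Rightarrow> (real \<Rightarrow> real) \<Rightarrow> bool" where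
  "extremal a b t g v \<longleftrightarrow>
     (\<forall>s\<in>{0..t}. (g has_real_derivative v s) (at s within {0..t})) \<and>
     (\<exists>L. L-lipschitz_on {0..t} v) \<and>
     (\<exists>w S. finite S \<and> (\<forall>s\<in>{0..t} - S. (v has_real_derivative w s) (at s) \<and>
        - b \<le> w s \<and> w s \<le> a \<and> potential a b (g s) = w s * g s))"

lemma potential_ge: "- b \<le> w \<Longrightarrow> w \<le> a \<Longrightarrow> w * z \<le> potential a b z"
  by (auto simp: potential_def intro: mult_right_mono)
    (metis linorder_not_le minus_mult_minus mult_right_mono_neg mult_minus_left less_imp_le)

lemma potential_continuous: "continuous_on A (potential a b)"
proof -
  have "potential a b = (\<lambda>z. a * max z 0 + b * max (- z) 0)"
    by (auto simp: potential_def fun_eq_iff)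
  then show ?thesis by (auto intro!: continuous_intros)
qed

lemma extremal_lipschitz:
  assumes "extremal a b t g v"
  shows "\<exists>L. L-lipschitz_on {0..t} g"
proof -
  from assms obtain L where "L-lipschitz_on {0..t} v" by (auto simp: extremal_def)
  then obtain B where B: "0 \<le> B" "\<And>s. s \<in> {0..t} \<Longrightarrow> \<bar>v s\<bar> \<le> B"
    using lipschitz_on_interval_bounded by blast
  have "B-lipschitz_on {0..t} g"
  proof (rule lipschitz_onI)
    fix x y assume xy: "x \<in> {0..t}" "y \<in> {0..t}"
    have "norm (g x - g y) \<le> B * norm (x - y)"
      using assms B xy
      by (intro field_differentiable_bound[of "{0..t}" g v]) (auto simp: extremal_def)
    then show "dist (g x) (g y) \<le> B * dist x y" by (simp add: dist_norm)
  qed (use B in simp)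
  then show ?thesis by blast
qed

lemma speed_measurable:
  assumes "L-lipschitz_on {0..t} y" "0 < t"
  shows "speed t y \<in> borel_measurable (lebesgue_on {0..t})"
  using lipschitz_lebesgue_vector_derivative(2)[OF assms] by (simp add: speed_def[abs_def])

lemma continuous_borel_measurable_lebesgue_on:
  fixes f :: "real \<Rightarrow> real"
  assumes "continuous_on {a..b} f"
  shows "f \<in> borel_measurable (lebesgue_on {a..b})"
  using assms by (intro continuous_imp_measurable_on_sets_lebesgue) auto

lemma integrable_speed_square:
  assumes y: "L-lipschitz_on {0..t} y" and t: "0 < t" and v: "continuous_on {0..t} v"
  shows "integrable (lebesgue_on {0..t}) (\<lambda>s. (speed t y s - v s)\<^sup>2)"
proof -
  interpret finite_measure "lebesgue_on {0..t}"
    by (rule finite_measure_lebesgue_on) simp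
  have "bounded (v ` {0..t})"
    using v by (intro compact_imp_bounded compact_continuous_image) auto
  then obtain B where B: "\<forall>x\<in>{0..t}. \<bar>v x\<bar> \<le> B"
    by (auto simp: bounded_iff)
  have "AE s in lebesgue_on {0..t}. norm ((speed t y s - v s)\<^sup>2) \<le> (L + B)\<^sup>2"
    using lipschitz_lebesgue_vector_derivative(1)[OF y t]
  proof eventually_elim
    case (elim s)
    then have "\<bar>speed t y s - v s\<bar> \<le> L + B"
      using B[rule_format, of s] by (auto simp: speed_def)
    then show ?case by (simp add: abs_le_square_iff[symmetric])
  qed
  then show ?thesis
    using speed_measurable[OF y t] continuous_borel_measurable_lebesgue_on[OF v]
    by (intro integrable_const_bound) auto
qed

lemma integrable_continuous_lebesgue_on:
  fixes f :: "real \<Rightarrow> real"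
  assumes "continuous_on {a..b} f"
  shows "integrable (lebesgue_on {a..b}) f"
proof -
  interpret finite_measure "lebesgue_on {a..b}"
    by (rule finite_measure_lebesgue_on) simp
  have "bounded (f ` {a..b})"
    using assms by (intro compact_imp_bounded compact_continuous_image) auto
  then obtain B where "\<forall>x\<in>{a..b}. \<bar>f x\<bar> \<le> B"
    by (auto simp: bounded_iff)
  then have "AE s in lebesgue_on {a..b}. norm (f s) \<le> B"
    by (auto simp: AE_restrict_space_iff)
  then show ?thesis
    using continuous_borel_measurable_lebesgue_on[OF assms] by (intro integrable_const_bound) auto
qed

lemma integrable_potential:
  fixes y :: "real \<Rightarrow> real"
  assumes y: "L-lipschitz_on {0..t} y"
  shows "integrable (lebesgue_on {0..t}) (\<lambda>s. potential a b (y s))"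
  by (intro integrable_continuous_lebesgue_on lipschitz_on_continuous_on[OF y]
      continuous_on_compose2[OF potential_continuous[of UNIV]]) auto

lemma integrable_running_cost:
  assumes y: "L-lipschitz_on {0..t} y" and t: "0 < t"
  shows "integrable (lebesgue_on {0..t}) (\<lambda>s. 1 / 2 * (speed t y s)\<^sup>2 + potential a b (y s))"
  using integrable_speed_square[OF y t, of "\<lambda>_. 0"] integrable_potential[OF y] by auto

text \<open>Integration by parts: the product \<open>v * y\<close> is Lipschitz, so the integral of
  its derivative is the boundary term. The curve \<open>y\<close> is left free because the identity
  is needed both for a competitor and for \<open>g\<close> itself.\<close>

lemma extremal_parts:
  assumes ext: "extremal a b t g v" and t: "0 < t" and y: "L-lipschitz_on {0..t} y"
  obtains w where
    "AE s in lebesgue_on {0..t}. speed t g s = v s \<and> - b \<le> w s \<and> w s \<le> a \<and> potential a b (g s) = w s * g s"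
    "integrable (lebesgue_on {0..t}) (\<lambda>s. v s * speed t y s + w s * y s)"
    "(\<integral>s. v s * speed t y s + w s * y s \<partial>lebesgue_on {0..t}) = v t * y t - v 0 * y 0"
proof -
  let ?M = "lebesgue_on {0..t}"
  from ext obtain K where v: "K-lipschitz_on {0..t} v" by (auto simp: extremal_def)
  from ext obtain w' S where S: "finite S"
    and w': "\<forall>s\<in>{0..t} - S. (v has_real_derivative w' s) (at s) \<and>
        - b \<le> w' s \<and> w' s \<le> a \<and> potential a b (g s) = w' s * g s"
    unfolding extremal_def by blast
  \<comment> \<open>Off the finite set \<open>S\<close> this agrees with the subgradient supplied by
    \<open>extremal\<close>; as a derivative of a Lipschitz function it is in addition known to be
    measurable.\<close>
  define w where "w = speed t v"
  have w: "(v has_real_derivative w s) (at s) \<and> - b \<le> w s \<and> w s \<le> a \<and> potential a b (g s) = w s * g s"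
    if s: "s \<in> {0..t} - S" for s
  proof -
    have "w s = w' s"
      unfolding w_def speed_def using s w' t
      by (intro vector_derivative_within_interval_eq) (auto intro: has_field_derivative_at_within)
    then show ?thesis using w' s by simp
  qed
  have "AE s in lebesgue. s \<notin> S"
    using S by (intro AE_not_in) (simp add: negligible_iff_null_sets[symmetric] negligible_finite)
  then have AS: "AE s in ?M. s \<in> {0..t} - S"
    by (auto simp: AE_restrict_space_iff elim!: eventually_mono)
  obtain A where A: "0 \<le> A" "\<And>s. s \<in> {0..t} \<Longrightarrow> \<bar>v s\<bar> \<le> A"
    using lipschitz_on_interval_bounded[OF v] by blast
  obtain B where B: "0 \<le> B" "\<And>s. s \<in> {0..t} \<Longrightarrow> \<bar>y s\<bar> \<le> B"
    using lipschitz_on_interval_bounded[OF y] by blast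
  have vy: "(A * L + B * K)-lipschitz_on {0..t} (\<lambda>s. v s * y s)"
    by (rule lipschitz_on_real_mult[OF v y A(2) B(2) A(1) B(1)])
  have ae: "AE s in ?M. speed t (\<lambda>s. v s * y s) s = v s * speed t y s + w s * y s"
    using AS lipschitz_lebesgue_vector_derivative(1)[OF vy t] lipschitz_lebesgue_vector_derivative(1)[OF y t]
  proof eventually_elim
    case (elim s)
    have "((\<lambda>s. v s * y s) has_real_derivative w s * y s + speed t y s * v s) (at s)"
      using w[OF elim(1)] elim(3) by (auto simp: speed_def intro!: DERIV_mult)
    then show ?case
      using elim(2) DERIV_unique by (fastforce simp: speed_def algebra_simps)
  qed
  have meas: "(\<lambda>s. v s * speed t y s + w s * y s) \<in> borel_measurable ?M"
    using speed_measurable[OF y t] speed_measurable[OF v t]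
      continuous_borel_measurable_lebesgue_on[OF lipschitz_on_continuous_on[OF v]]
      continuous_borel_measurable_lebesgue_on[OF lipschitz_on_continuous_on[OF y]]
    unfolding w_def by (intro borel_measurable_add borel_measurable_times)
  show ?thesis
  proof
    show "AE s in ?M. speed t g s = v s \<and> - b \<le> w s \<and> w s \<le> a \<and> potential a b (g s) = w s * g s"
      using AS
    proof eventually_elim
      case (elim s)
      then show ?case
        using w[OF elim] ext t
        by (auto simp: speed_def extremal_def intro!: vector_derivative_within_interval_eq)
    qed
    show "integrable ?M (\<lambda>s. v s * speed t y s + w s * y s)"
      using lipschitz_lebesgue_vector_derivative(3)[OF vy t] ae meas
      by (subst integrable_cong_AE[where g = "speed t (\<lambda>s. v s * y s)"])
        (auto simp: speed_def[abs_def] intro: borel_measurable_integrable)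
    have "(\<integral>s. v s * speed t y s + w s * y s \<partial>?M) = (\<integral>s. speed t (\<lambda>s. v s * y s) s \<partial>?M)"
      using ae meas speed_measurable[OF vy t] by (intro integral_cong_AE) auto
    then show "(\<integral>s. v s * speed t y s + w s * y s \<partial>?M) = v t * y t - v 0 * y 0"
      using lipschitz_lebesgue_vector_derivative(4)[OF vy t] by (simp add: speed_def[abs_def])
  qed
qed

text \<open>Testing \<open>extremal_parts\<close> with \<open>y = g\<close> turns the potential into
  \<open>w * g\<close>, so the potential never has to be integrated: the speed alone determines the
  value. This is what the explicit formulas are checked against.\<close>

lemma extremal_value:
  assumes ext: "extremal a b t g v" and t: "0 < t"
  shows "running_cost a b t g + v 0 * g 0 = v t * g t - 1 / 2 * (\<integral>s. (v s)\<^sup>2 \<partial>lebesgue_on {0..t})"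
proof -
  let ?M = "lebesgue_on {0..t}"
  obtain L where g: "L-lipschitz_on {0..t} g" using extremal_lipschitz[OF ext] by blast
  obtain K where v: "K-lipschitz_on {0..t} v" using ext by (auto simp: extremal_def)
  obtain w where w: "AE s in ?M. speed t g s = v s \<and> - b \<le> w s \<and> w s \<le> a \<and> potential a b (g s) = w s * g s"
    and int: "integrable ?M (\<lambda>s. v s * speed t g s + w s * g s)"
    and eq: "(\<integral>s. v s * speed t g s + w s * g s \<partial>?M) = v t * g t - v 0 * g 0"
    using extremal_parts[OF ext t g] by blast
  have v2: "integrable ?M (\<lambda>s. (v s)\<^sup>2)"
    by (intro integrable_continuous_lebesgue_on continuous_intros lipschitz_on_continuous_on[OF v])
  have "running_cost a b t g = (\<integral>s. (v s * speed t g s + w s * g s) - 1 / 2 * (v s)\<^sup>2 \<partial>?M)"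
    unfolding running_cost_def
  proof (intro integral_cong_AE borel_measurable_integrable integrable_running_cost[OF g t] Bochner_Integration.integrable_diff int)
    show "integrable ?M (\<lambda>s. 1 / 2 * (v s)\<^sup>2)" using v2 by simp
    show "AE s in ?M. 1 / 2 * (speed t g s)\<^sup>2 + potential a b (g s)
        = v s * speed t g s + w s * g s - 1 / 2 * (v s)\<^sup>2"
      using w by eventually_elim (simp add: power2_eq_square)
  qed
  also have "\<dots> = (v t * g t - v 0 * g 0) - 1 / 2 * (\<integral>s. (v s)\<^sup>2 \<partial>?M)"
    using int v2 eq by (subst Bochner_Integration.integral_diff) auto
  finally show ?thesis by simp
qed

text \<open>Pointwise, half the square of \<open>y'\<close> equals
  \<open>v * y' - v\<^sup>2 / 2 + (y' - v)\<^sup>2 / 2\<close>, and the potential at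
  \<open>y\<close> is at least \<open>w * y\<close>. The terms linear in \<open>y\<close> integrate
  to boundary terms, and those at \<open>t\<close> agree for both curves.\<close>

lemma extremal_minimises:
  assumes ext: "extremal a b t g v" and t: "0 < t"
    and y: "L-lipschitz_on {0..t} y" and yt: "y t = g t"
  shows "running_cost a b t g + v 0 * g 0 + 1 / 2 * (\<integral>s. (speed t y s - v s)\<^sup>2 \<partial>lebesgue_on {0..t})
    \<le> running_cost a b t y + v 0 * y 0"
proof -
  let ?M = "lebesgue_on {0..t}"
  obtain K where v: "K-lipschitz_on {0..t} v" using ext by (auto simp: extremal_def)
  note v_cont = lipschitz_on_continuous_on[OF v]
  obtain w where w: "AE s in ?M. speed t g s = v s \<and> - b \<le> w s \<and> w s \<le> a \<and> potential a b (g s) = w s * g s"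
    and int: "integrable ?M (\<lambda>s. v s * speed t y s + w s * y s)"
    and eq: "(\<integral>s. v s * speed t y s + w s * y s \<partial>?M) = v t * y t - v 0 * y 0"
    using extremal_parts[OF ext t y] by blast
  have v2: "integrable ?M (\<lambda>s. (v s)\<^sup>2)"
    by (intro integrable_continuous_lebesgue_on continuous_intros v_cont)
  note d2 = integrable_speed_square[OF y t v_cont]
  have "(v t * y t - v 0 * y 0) - 1 / 2 * (\<integral>s. (v s)\<^sup>2 \<partial>?M) + 1 / 2 * (\<integral>s. (speed t y s - v s)\<^sup>2 \<partial>?M)
      = (\<integral>s. (v s * speed t y s + w s * y s) - 1 / 2 * (v s)\<^sup>2 + 1 / 2 * (speed t y s - v s)\<^sup>2 \<partial>?M)"
    using int v2 d2 eq by simp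
  also have "\<dots> \<le> running_cost a b t y"
    unfolding running_cost_def
  proof (rule integral_mono_AE)
    show "AE s in ?M. v s * speed t y s + w s * y s - 1 / 2 * (v s)\<^sup>2 + 1 / 2 * (speed t y s - v s)\<^sup>2
        \<le> 1 / 2 * (speed t y s)\<^sup>2 + potential a b (y s)"
      using w
    proof eventually_elim
      case (elim s)
      then show ?case
        using potential_ge[of b "w s" a "y s"] by (simp add: power2_eq_square algebra_simps)
    qed
  qed (use int v2 d2 integrable_running_cost[OF y t] in auto)
  finally show ?thesis
    using extremal_value[OF ext t] yt by simp
qed

text \<open>The difference of the curves vanishes at \<open>t\<close>, so its value at
  \<open>s\<close> is minus the integral of its derivative over \<open>{s..t}\<close>, and
  Cauchy--Schwarz applies.\<close>

lemma deviation_le_speed_deviation: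
  assumes ext: "extremal a b t g v" and t: "0 < t"
    and y: "L-lipschitz_on {0..t} y" and yt: "y t = g t" and s: "s \<in> {0..t}"
  shows "(y s - g s)\<^sup>2 \<le> t * (\<integral>s. (speed t y s - v s)\<^sup>2 \<partial>lebesgue_on {0..t})"
proof -
  let ?M = "lebesgue_on {0..t}"
  obtain K where v: "K-lipschitz_on {0..t} v" using ext by (auto simp: extremal_def)
  note v_cont = lipschitz_on_continuous_on[OF v]
  obtain L' where g: "L'-lipschitz_on {0..t} g" using extremal_lipschitz[OF ext] by blast
  define d where "d r = y r - g r" for r
  text \<open>Freezing the difference before \<open>s\<close> allows Cauchy--Schwarz on all of \<open>{0..t}\<close>.\<close>
  define e where "e r = d (max r s)" for r
  have d_lip: "(L + L')-lipschitz_on {0..t} d"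
    unfolding d_def by (intro lipschitz_on_diff y g)
  have e_lip: "(L + L')-lipschitz_on {0..t} e"
  proof (rule lipschitz_onI)
    show nn: "0 \<le> L + L'" using d_lip by (rule lipschitz_on_nonneg)
    fix p q assume pq: "p \<in> {0..t}" "q \<in> {0..t}"
    have "dist (e p) (e q) \<le> (L + L') * dist (max p s) (max q s)"
      unfolding e_def using pq s by (intro lipschitz_onD[OF d_lip]) auto
    also have "\<dots> \<le> (L + L') * dist p q"
      using nn by (intro mult_left_mono) (auto simp: dist_real_def)
    finally show "dist (e p) (e q) \<le> (L + L') * dist p q" .
  qed
  have "AE r in lebesgue. r \<notin> {s}"
    by (intro AE_not_in) (simp add: negligible_iff_null_sets[symmetric])
  then have As: "AE r in ?M. r \<noteq> s"
    by (auto simp: AE_restrict_space_iff elim!: eventually_mono)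
  have e_le: "AE r in ?M. (speed t e r)\<^sup>2 \<le> (speed t y r - v r)\<^sup>2"
    using As lipschitz_lebesgue_vector_derivative(1)[OF e_lip t] lipschitz_lebesgue_vector_derivative(1)[OF y t]
  proof eventually_elim
    case (elim r)
    then have r: "0 < r" "r < t" by auto
    have e': "(e has_real_derivative speed t e r) (at r)" and y': "(y has_real_derivative speed t y r) (at r)"
      using elim by (auto simp: speed_def)
    have "r \<in> interior {0..t}" using r by simp
    then have "at r within {0..t} = at r" by (rule at_within_interior)
    then have g': "(g has_real_derivative v r) (at r)"
      using ext r by (auto simp: extremal_def dest: bspec[of _ _ r])
    show ?case
    proof (cases "r < s")
      case True
      have "(e has_real_derivative 0) (at r)"
        unfolding has_real_derivative_iff_has_vector_derivative
        by (rule has_vector_derivative_transform_within_open[of "\<lambda>_. d s" _ _ "{..<s}"])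
          (use True in \<open>auto simp: e_def\<close>)
      then show ?thesis using DERIV_unique[OF e'] by simp
    next
      case False
      have "(d has_real_derivative speed t y r - v r) (at r)"
        unfolding d_def by (rule DERIV_diff[OF y' g'])
      then have "(e has_real_derivative speed t y r - v r) (at r)"
        unfolding has_real_derivative_iff_has_vector_derivative
        by (rule has_vector_derivative_transform_within_open[of d _ _ "{s<..}"])
          (use False elim in \<open>auto simp: e_def\<close>)
      then show ?thesis using DERIV_unique[OF e'] by simp
    qed
  qed
  have e2: "integrable ?M (\<lambda>r. (speed t e r)\<^sup>2)"
    using integrable_speed_square[OF e_lip t, of "\<lambda>_. 0"] by simp
  have e1: "integrable ?M (speed t e)" "(\<integral>r. speed t e r \<partial>?M) = - d s"
  proof -
    have "e t = 0" "e 0 = d s" using s yt by (auto simp: e_def d_def max_absorb1 max_absorb2)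
    then show "integrable ?M (speed t e)" "(\<integral>r. speed t e r \<partial>?M) = - d s"
      using lipschitz_lebesgue_vector_derivative(3,4)[OF e_lip t] by (simp_all add: speed_def[abs_def])
  qed
  have M: "measure ?M (space ?M) = t" "finite_measure ?M"
    using t by (auto simp: measure_restrict_space intro: finite_measure_lebesgue_on)
  interpret finite_measure ?M by fact
  \<comment> \<open>This is the mean of the derivative of \<open>e\<close>; integrating the square
    of the deviation from the mean is Cauchy--Schwarz against the constant 1.\<close>
  define c where "c = - d s / t"
  have "0 \<le> (\<integral>r. (speed t e r - c)\<^sup>2 \<partial>?M)" by simp
  also have "(\<integral>r. (speed t e r - c)\<^sup>2 \<partial>?M) = (\<integral>r. (speed t e r)\<^sup>2 - 2 * c * speed t e r + c\<^sup>2 \<partial>?M)"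
    by (simp add: power2_diff algebra_simps)
  also have "\<dots> = (\<integral>r. (speed t e r)\<^sup>2 \<partial>?M) - 2 * c * (- d s) + c\<^sup>2 * t"
    using e1 e2 M by simp
  also have "\<dots> = (\<integral>r. (speed t e r)\<^sup>2 \<partial>?M) - (d s)\<^sup>2 / t"
    using t by (simp add: c_def power2_eq_square field_simps)
  finally have "(d s)\<^sup>2 \<le> t * (\<integral>r. (speed t e r)\<^sup>2 \<partial>?M)"
    using t by (simp add: field_simps)
  also have "\<dots> \<le> t * (\<integral>r. (speed t y r - v r)\<^sup>2 \<partial>?M)"
    using t e_le e2 integrable_speed_square[OF y t v_cont] by (intro mult_left_mono integral_mono_AE) auto
  finally show ?thesis by (simp add: d_def)
qed

subsection \<open>The explicit extremals\<close>

text \<open>The squared positive part is continuously differentiable across \<open>c\<close>. Curves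
  that change acceleration can thus be written by one formula and need no gluing at the switching
  times.\<close>

lemma has_real_derivative_half_square_pos_part:
  "((\<lambda>s. (max (s - c) 0)\<^sup>2 / 2) has_real_derivative max (s - c) 0) (at s)"
proof -
  consider "s < c" | "s = c" | "c < s" by linarith
  then show ?thesis
  proof cases
    case 1
    have "((\<lambda>s. (max (s - c) 0)\<^sup>2 / 2) has_vector_derivative 0) (at s)"
      by (rule has_vector_derivative_transform_within_open[of "\<lambda>_. 0" 0 s "{..<c}"]) (use 1 in auto)
    then show ?thesis using 1 by (simp add: has_real_derivative_iff_has_vector_derivative)
  next
    case 2
    have "((\<lambda>h::real. ((max h 0)\<^sup>2 / 2) / h) \<longlongrightarrow> 0) (at 0)"
    proof (rule tendsto_0_le[of "\<lambda>h::real. h" _ _ 1])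
      show "\<forall>\<^sub>F h in at 0. norm ((max h 0)\<^sup>2 / 2 / h) \<le> norm (h::real) * 1"
        by (intro always_eventually allI) (simp add: max_def power2_eq_square)
    qed simp
    then show ?thesis using 2 by (simp add: DERIV_def)
  next
    case 3
    have "((\<lambda>s. (s - c)\<^sup>2 / 2) has_real_derivative (s - c)) (at s)"
      by (auto intro!: derivative_eq_intros)
    then have "((\<lambda>s. (max (s - c) 0)\<^sup>2 / 2) has_vector_derivative (s - c)) (at s)"
      unfolding has_real_derivative_iff_has_vector_derivative
      by (rule has_vector_derivative_transform_within_open[of _ _ s "{c<..}"]) (use 3 in auto)
    then show ?thesis using 3 by (simp add: has_real_derivative_iff_has_vector_derivative)
  qed
qed

text \<open>All explicit trajectories have acceleration \<open>-b\<close> before \<open>\<alpha>\<close>, \<open>0\<close> between \<open>\<alpha>\<close> and \<open>\<beta>\<close>, and \<open>c\<close> after \<open>\<beta>\<close>.\<close>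

definition phase_speed :: "real \<Rightarrow> real \<Rightarrow> real \<Rightarrow> real \<Rightarrow> real \<Rightarrow> real \<Rightarrow> real" where
  "phase_speed b c \<alpha> \<beta> p s = p - b * (s - max (s - \<alpha>) 0) + c * max (s - \<beta>) 0"

definition phase_curve :: "real \<Rightarrow> real \<Rightarrow> real \<Rightarrow> real \<Rightarrow> real \<Rightarrow> real \<Rightarrow> real \<Rightarrow> real" where
  "phase_curve b c \<alpha> \<beta> p z s =
     z + p * s - b * (s\<^sup>2 / 2 - (max (s - \<alpha>) 0)\<^sup>2 / 2) + c * ((max (s - \<beta>) 0)\<^sup>2 / 2)"

lemma phase_curve_has_derivative:
  "(phase_curve b c \<alpha> \<beta> p z has_real_derivative phase_speed b c \<alpha> \<beta> p s) (at s)"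
proof -
  have "((\<lambda>s. z + p * s - b * (s\<^sup>2 / 2 - A s) + c * B s) has_real_derivative p - b * (s - A') + c * B') (at s)"
    if "(A has_real_derivative A') (at s)" "(B has_real_derivative B') (at s)" for A B A' B'
    using that by (auto intro!: derivative_eq_intros)
  from this[OF has_real_derivative_half_square_pos_part has_real_derivative_half_square_pos_part]
  show ?thesis unfolding phase_curve_def[abs_def] phase_speed_def .
qed

lemma phase_speed_lipschitz: "(\<bar>b\<bar> + \<bar>c\<bar>)-lipschitz_on S (phase_speed b c \<alpha> \<beta> p)"
proof (rule lipschitz_onI)
  fix x y
  \<comment> \<open>Since \<open>s - max (s - \<alpha>) 0\<close> is \<open>min s \<alpha>\<close>,
    the speed is a combination of two functions with Lipschitz constant 1.\<close>
  have "phase_speed b c \<alpha> \<beta> p x - phase_speed b c \<alpha> \<beta> p y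
      = b * (min y \<alpha> - min x \<alpha>) + c * (max (x - \<beta>) 0 - max (y - \<beta>) 0)"
    by (simp add: phase_speed_def min_def max_def algebra_simps)
  also have "\<bar>\<dots>\<bar> \<le> \<bar>b\<bar> * \<bar>min y \<alpha> - min x \<alpha>\<bar> + \<bar>c\<bar> * \<bar>max (x - \<beta>) 0 - max (y - \<beta>) 0\<bar>"
    by (metis abs_mult abs_triangle_ineq)
  also have "\<dots> \<le> \<bar>b\<bar> * \<bar>x - y\<bar> + \<bar>c\<bar> * \<bar>x - y\<bar>"
    by (intro add_mono mult_left_mono) auto
  finally show "dist (phase_speed b c \<alpha> \<beta> p x) (phase_speed b c \<alpha> \<beta> p y) \<le> (\<bar>b\<bar> + \<bar>c\<bar>) * dist x y"
    by (simp add: dist_real_def algebra_simps)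
qed simp

lemma has_real_derivative_phase_speed:
  assumes "\<alpha> \<le> \<beta>" "s \<noteq> \<alpha>" "s \<noteq> \<beta>"
  shows "(phase_speed b c \<alpha> \<beta> p has_real_derivative (if s < \<alpha> then - b else if s < \<beta> then 0 else c)) (at s)"
proof -
  consider "s < \<alpha>" | "\<alpha> < s" "s < \<beta>" | "\<beta> < s" using assms by linarith
  then show ?thesis
  proof cases
    case 1
    have "((\<lambda>s. p - b * s) has_real_derivative - b) (at s)" by (auto intro!: derivative_eq_intros)
    then have "(phase_speed b c \<alpha> \<beta> p has_vector_derivative - b) (at s)"
      unfolding has_real_derivative_iff_has_vector_derivative
      by (rule has_vector_derivative_transform_within_open[of _ _ s "{..<\<alpha>}"])
        (use 1 assms in \<open>auto simp: phase_speed_def\<close>)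
    then show ?thesis using 1 by (simp add: has_real_derivative_iff_has_vector_derivative)
  next
    case 2
    have "((\<lambda>s. p - b * \<alpha>) has_real_derivative 0) (at s)" by simp
    then have "(phase_speed b c \<alpha> \<beta> p has_vector_derivative 0) (at s)"
      unfolding has_real_derivative_iff_has_vector_derivative
      by (rule has_vector_derivative_transform_within_open[of _ _ s "{\<alpha><..<\<beta>}"])
        (use 2 in \<open>auto simp: phase_speed_def\<close>)
    then show ?thesis using 2 by (simp add: has_real_derivative_iff_has_vector_derivative)
  next
    case 3
    have "((\<lambda>s. p - b * \<alpha> + c * (s - \<beta>)) has_real_derivative c) (at s)"
      by (auto intro!: derivative_eq_intros)
    then have "(phase_speed b c \<alpha> \<beta> p has_vector_derivative c) (at s)"
      unfolding has_real_derivative_iff_has_vector_derivative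
      by (rule has_vector_derivative_transform_within_open[of _ _ s "{\<beta><..}"])
        (use 3 assms in \<open>auto simp: phase_speed_def\<close>)
    then show ?thesis using 3 assms by (simp add: has_real_derivative_iff_has_vector_derivative)
  qed
qed

text \<open>In each phase the acceleration has to be a subgradient of the potential:
  \<open>- b\<close> on the nonpositive side, \<open>a\<close> on the nonnegative side, and 0 is
  admissible at rest in the origin. The hypothesis \<open>0 \<le> c * g s\<close> expresses the
  right side for both choices of \<open>c\<close>.\<close>

lemma extremal_phase_curve:
  assumes ab: "0 < a" "0 < b" and ord: "0 \<le> \<alpha>" "\<alpha> \<le> \<beta>" "\<beta> \<le> t" and c: "c = a \<or> c = - b"
    and g: "\<And>s. s \<in> {0..t} \<Longrightarrow> g s = phase_curve b c \<alpha> \<beta> p z s"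
    and neg: "\<And>s. 0 \<le> s \<Longrightarrow> s < \<alpha> \<Longrightarrow> g s \<le> 0"
    and zero: "\<And>s. \<alpha> < s \<Longrightarrow> s < \<beta> \<Longrightarrow> g s = 0"
    and last: "\<And>s. \<beta> < s \<Longrightarrow> s \<le> t \<Longrightarrow> 0 \<le> c * g s"
  shows "extremal a b t g (phase_speed b c \<alpha> \<beta> p)"
  unfolding extremal_def
proof (intro conjI)
  show "\<forall>s\<in>{0..t}. (g has_real_derivative phase_speed b c \<alpha> \<beta> p s) (at s within {0..t})"
  proof
    fix s assume s: "s \<in> {0..t}"
    have "(phase_curve b c \<alpha> \<beta> p z has_real_derivative phase_speed b c \<alpha> \<beta> p s) (at s within {0..t})"
      by (rule has_field_derivative_at_within[OF phase_curve_has_derivative])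
    then show "(g has_real_derivative phase_speed b c \<alpha> \<beta> p s) (at s within {0..t})"
      by (rule has_field_derivative_transform_within[of _ _ _ _ 1]) (use g s in auto)
  qed
  show "\<exists>L. L-lipschitz_on {0..t} (phase_speed b c \<alpha> \<beta> p)"
    using phase_speed_lipschitz by blast
  let ?w = "\<lambda>s. if s < \<alpha> then - b else if s < \<beta> then 0 else c"
  have "- b \<le> ?w s \<and> ?w s \<le> a \<and> potential a b (g s) = ?w s * g s" if s: "s \<in> {0..t} - {\<alpha>, \<beta>}" for s
  proof -
    consider "s < \<alpha>" | "\<alpha> < s" "s < \<beta>" | "\<beta> < s" using s by force
    then show ?thesis
    proof cases
      case 1
      then show ?thesis using neg[of s] ab s by (auto simp: potential_def)
    next
      case 2
      then show ?thesis using zero[of s] ab by (simp add: potential_def)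
    next
      case 3
      then show ?thesis using last[of s] ab s c ord
        by (auto simp: potential_def zero_le_mult_iff mult_le_0_iff)
    qed
  qed
  then show "\<exists>w S. finite S \<and> (\<forall>s\<in>{0..t} - S. (phase_speed b c \<alpha> \<beta> p has_real_derivative w s) (at s) \<and>
      - b \<le> w s \<and> w s \<le> a \<and> potential a b (g s) = w s * g s)"
    using has_real_derivative_phase_speed[OF ord(2)]
    by (intro exI[of _ ?w] exI[of _ "{\<alpha>, \<beta>}"]) auto
qed

lemma has_integral_affine_square:
  fixes m k :: real
  assumes "m \<noteq> 0" "u \<le> v"
  shows "((\<lambda>s. (k + m * s)\<^sup>2) has_integral ((k + m * v) ^ 3 - (k + m * u) ^ 3) / (3 * m)) {u..v}"
proof -
  have "((\<lambda>s. (k + m * s)\<^sup>2) has_integral (k + m * v) ^ 3 / (3 * m) - (k + m * u) ^ 3 / (3 * m)) {u..v}"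
  proof (rule fundamental_theorem_of_calculus)
    fix s
    have "((\<lambda>s. (k + m * s) ^ 3 / (3 * m)) has_real_derivative (k + m * s)\<^sup>2) (at s within {u..v})"
      using assms by (auto intro!: derivative_eq_intros simp: field_simps power2_eq_square)
    then show "((\<lambda>s. (k + m * s) ^ 3 / (3 * m)) has_vector_derivative (k + m * s)\<^sup>2) (at s within {u..v})"
      by (simp add: has_real_derivative_iff_has_vector_derivative)
  qed (use assms in simp)
  then show ?thesis by (simp add: diff_divide_distrib)
qed

text \<open>By \<open>rest\<close> a middle phase of positive length has speed 0, so only the two
  outer phases contribute, each the integral of the square of an affine function.\<close>

lemma integral_phase_speed_square:
  assumes "b \<noteq> 0" "c \<noteq> 0" and ord: "0 \<le> \<alpha>" "\<alpha> \<le> \<beta>" "\<beta> \<le> t" and rest: "\<alpha> = \<beta> \<or> p = b * \<alpha>"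
  shows "(\<integral>s. (phase_speed b c \<alpha> \<beta> p s)\<^sup>2 \<partial>lebesgue_on {0..t}) =
    (p ^ 3 - (p - b * \<alpha>) ^ 3) / (3 * b) + ((p - b * \<alpha> + c * (t - \<beta>)) ^ 3 - (p - b * \<alpha>) ^ 3) / (3 * c)"
proof -
  let ?f = "\<lambda>s. (phase_speed b c \<alpha> \<beta> p s)\<^sup>2"
  have 0: "((p + - b * \<alpha>) ^ 3 - (p + - b * 0) ^ 3) / (3 * - b) = (p ^ 3 - (p - b * \<alpha>) ^ 3) / (3 * b)"
    by (simp add: minus_divide_left)
  have "((\<lambda>s. (p + - b * s)\<^sup>2) has_integral ((p + - b * \<alpha>) ^ 3 - (p + - b * 0) ^ 3) / (3 * - b)) {0..\<alpha>}"
    by (rule has_integral_affine_square) (use assms in simp_all)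
  then have "((\<lambda>s. (p + - b * s)\<^sup>2) has_integral (p ^ 3 - (p - b * \<alpha>) ^ 3) / (3 * b)) {0..\<alpha>}"
    unfolding 0 .
  then have 1: "(?f has_integral (p ^ 3 - (p - b * \<alpha>) ^ 3) / (3 * b)) {0..\<alpha>}"
    by (rule has_integral_eq[rotated]) (use ord in \<open>simp add: phase_speed_def\<close>)
  have 2: "(?f has_integral 0) {\<alpha>..\<beta>}"
  proof (cases "\<alpha> = \<beta>")
    case False
    show ?thesis
      by (rule has_integral_eq[OF _ has_integral_0]) (use rest False in \<open>simp add: phase_speed_def\<close>)
  qed auto
  have eq: "p - b * \<alpha> - c * \<beta> + c * s = p - b * \<alpha> + c * (s - \<beta>)" for s
    by (simp add: algebra_simps)
  have "((\<lambda>s. (p - b * \<alpha> + c * (s - \<beta>))\<^sup>2) has_integral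
      ((p - b * \<alpha> + c * (t - \<beta>)) ^ 3 - (p - b * \<alpha>) ^ 3) / (3 * c)) {\<beta>..t}"
    using has_integral_affine_square[OF \<open>c \<noteq> 0\<close> ord(3), of "p - b * \<alpha> - c * \<beta>"] by (simp add: eq)
  then have 3: "(?f has_integral ((p - b * \<alpha> + c * (t - \<beta>)) ^ 3 - (p - b * \<alpha>) ^ 3) / (3 * c)) {\<beta>..t}"
    by (rule has_integral_eq[rotated]) (use ord in \<open>simp add: phase_speed_def\<close>)
  have "(?f has_integral (p ^ 3 - (p - b * \<alpha>) ^ 3) / (3 * b) + 0
      + ((p - b * \<alpha> + c * (t - \<beta>)) ^ 3 - (p - b * \<alpha>) ^ 3) / (3 * c)) {0..t}"
    using ord by (intro has_integral_combine[OF _ _ has_integral_combine[OF _ _ 1 2] 3]) auto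
  moreover have "integrable (lebesgue_on {0..t}) ?f"
    by (intro integrable_continuous_lebesgue_on continuous_intros lipschitz_on_continuous_on[OF phase_speed_lipschitz])
  ultimately show ?thesis
    by (simp add: lebesgue_integral_eq_integral integral_unique)
qed

text \<open>For \<open>t > 0\<close>, \<open>extremal_value\<close> identifies \<open>V\<close> with
  the running cost of \<open>g\<close> plus \<open>p * g 0\<close>. The form in terms of
  \<open>v\<close> is the one that can be evaluated phase by phase.\<close>

definition extremal_with_value ::
  "real \<Rightarrow> real \<Rightarrow> real \<Rightarrow> real \<Rightarrow> real \<Rightarrow> (real \<Rightarrow> real) \<Rightarrow> real \<Rightarrow> bool" where
  "extremal_with_value a b t x p g V \<longleftrightarrow> (\<exists>v. extremal a b t g v \<and> v 0 = p \<and> g t = x \<and>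
     V = v t * x - 1 / 2 * (\<integral>s. (v s)\<^sup>2 \<partial>lebesgue_on {0..t}))"

lemma extremal_with_value_phase_curve:
  assumes ab: "0 < a" "0 < b" and ord: "0 \<le> \<alpha>" "\<alpha> \<le> \<beta>" "\<beta> \<le> t" and c: "c = a \<or> c = - b"
    and rest: "\<alpha> = \<beta> \<or> p = b * \<alpha>"
    and g: "\<And>s. s \<in> {0..t} \<Longrightarrow> g s = phase_curve b c \<alpha> \<beta> p z s"
    and neg: "\<And>s. 0 \<le> s \<Longrightarrow> s < \<alpha> \<Longrightarrow> g s \<le> 0"
    and zero: "\<And>s. \<alpha> < s \<Longrightarrow> s < \<beta> \<Longrightarrow> g s = 0"
    and last: "\<And>s. \<beta> < s \<Longrightarrow> s \<le> t \<Longrightarrow> 0 \<le> c * g s"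
    and x: "g t = x"
    and V: "V = (p - b * \<alpha> + c * (t - \<beta>)) * x - 1 / 2 * ((p ^ 3 - (p - b * \<alpha>) ^ 3) / (3 * b)
        + ((p - b * \<alpha> + c * (t - \<beta>)) ^ 3 - (p - b * \<alpha>) ^ 3) / (3 * c))"
  shows "extremal_with_value a b t x p g V"
  unfolding extremal_with_value_def
proof (intro exI conjI)
  show "extremal a b t g (phase_speed b c \<alpha> \<beta> p)"
    using assms by (intro extremal_phase_curve) auto
  show "phase_speed b c \<alpha> \<beta> p 0 = p"
    using ord by (simp add: phase_speed_def)
  have "phase_speed b c \<alpha> \<beta> p t = p - b * \<alpha> + c * (t - \<beta>)"
    using ord by (simp add: phase_speed_def)
  then show "V = phase_speed b c \<alpha> \<beta> p t * x - 1 / 2 * (\<integral>s. (phase_speed b c \<alpha> \<beta> p s)\<^sup>2 \<partial>lebesgue_on {0..t})"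
    unfolding V by (subst integral_phase_speed_square) (use ord rest ab c in auto)
qed (rule x)

text \<open>Reflection at the origin exchanges the two slopes of the potential; this covers initial
  slopes \<open>p < 0\<close>.\<close>

lemma extremal_with_value_uminus:
  assumes "extremal_with_value b a t (- x) (- p) g V"
  shows "extremal_with_value a b t x p (\<lambda>s. - g s) V"
proof -
  from assms obtain v where v: "extremal b a t g v" "v 0 = - p" "g t = - x"
    "V = v t * (- x) - 1 / 2 * (\<integral>s. (v s)\<^sup>2 \<partial>lebesgue_on {0..t})"
    by (auto simp: extremal_with_value_def)
  from v(1) obtain L w S where
    g: "\<forall>s\<in>{0..t}. (g has_real_derivative v s) (at s within {0..t})" and L: "L-lipschitz_on {0..t} v"
    and S: "finite S" and w: "\<forall>s\<in>{0..t} - S. (v has_real_derivative w s) (at s) \<and>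
        - a \<le> w s \<and> w s \<le> b \<and> potential b a (g s) = w s * g s"
    unfolding extremal_def by blast
  have w_le: "- w s \<le> a" if "s \<in> {0..t} - S" for s
    using bspec[OF w that] by linarith
  have pot: "potential a b (- z) = potential b a z" for z
    by (auto simp: potential_def)
  have "extremal a b t (\<lambda>s. - g s) (\<lambda>s. - v s)"
    unfolding extremal_def
  proof (intro conjI)
    show "\<exists>w S. finite S \<and> (\<forall>s\<in>{0..t} - S. ((\<lambda>s. - v s) has_real_derivative w s) (at s) \<and>
      - b \<le> w s \<and> w s \<le> a \<and> potential a b (- g s) = w s * - g s)"
      using S w w_le by (intro exI[of _ "\<lambda>s. - w s"] exI[of _ S]) (auto simp: pot intro!: DERIV_minus)
  qed (use g L in \<open>auto intro!: DERIV_minus lipschitz_on_minus\<close>)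
  then show ?thesis
    unfolding extremal_with_value_def using v by (intro exI[of _ "\<lambda>s. - v s"]) simp
qed

section \<open>The five regions of the explicit formula\<close>

lemma Omega1_extremal:
  assumes ab: "0 < a" "0 < b" and t: "0 < t" and mem: "(x, t, p) \<in> Omega1 a b"
  shows "extremal_with_value a b t x p (\<lambda>s. x - p * (t - s) - a / 2 * (t\<^sup>2 - s\<^sup>2)) (f1 x t p a b)"
\<comment> \<open>Only the last phase occurs: in this region the curve starts at a nonnegative
  position with nonnegative speed and accelerates.\<close>
proof (rule extremal_with_value_phase_curve[where \<alpha> = 0 and \<beta> = 0 and c = a and z = "x - p * t - a / 2 * t\<^sup>2"])
  have m: "0 \<le> p" "p * t + a / 2 * t\<^sup>2 \<le> x" using mem by (auto simp: Omega1_def)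
  show "0 \<le> a * (x - p * (t - s) - a / 2 * (t\<^sup>2 - s\<^sup>2))" if "0 < s" for s
  proof -
    have "0 \<le> p * s" "0 \<le> a / 2 * s\<^sup>2" using that m ab by auto
    then have "0 \<le> x - p * (t - s) - a / 2 * (t\<^sup>2 - s\<^sup>2)" using m by (simp add: algebra_simps)
    then show ?thesis using ab by simp
  qed
  show "f1 x t p a b = (p - b * 0 + a * (t - 0)) * x - 1 / 2 * ((p ^ 3 - (p - b * 0) ^ 3) / (3 * b)
        + ((p - b * 0 + a * (t - 0)) ^ 3 - (p - b * 0) ^ 3) / (3 * a))"
    using ab by (simp add: f1_def field_simps power2_eq_square power3_eq_cube)
qed (use ab t in \<open>auto simp: phase_curve_def algebra_simps\<close>)

lemma Omega2_extremal:
  assumes ab: "0 < a" "0 < b" and t: "0 < t" and mem: "(x, t, p) \<in> Omega2 a b"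
  shows "extremal_with_value a b t x p (\<lambda>s. x - p * (t - s) + b / 2 * (t\<^sup>2 - s\<^sup>2)) (f2 x t p a b)"
proof (rule extremal_with_value_phase_curve[where \<alpha> = t and \<beta> = t and c = a and z = "x - p * t + b / 2 * t\<^sup>2"])
  show "x - p * (t - s) + b / 2 * (t\<^sup>2 - s\<^sup>2) \<le> 0" if s: "0 \<le> s" "s < t" for s
  \<comment> \<open>For \<open>t < p / b\<close> the mean speed between \<open>s\<close> and
    \<open>t\<close> is positive, so the curve stays below its endpoint, which is negative.
    Otherwise completing the square exhibits the maximum, at time \<open>p / b\<close>, and the
    region says that it is negative.\<close>
  proof (cases "t < p / b")
    case True
    have "b * ((t + s) / 2) \<le> b * t" using s ab by (intro mult_left_mono) auto
    also have "\<dots> < p" using True ab by (simp add: field_simps)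
    finally have "0 \<le> (p - b * ((t + s) / 2)) * (t - s)" using s by simp
    moreover have "x - p * (t - s) + b / 2 * (t\<^sup>2 - s\<^sup>2) = x - (p - b * ((t + s) / 2)) * (t - s)"
      by (simp add: field_simps power2_eq_square)
    moreover have "x \<le> 0"
      using mem True by (auto simp: Omega2_def)
    ultimately show ?thesis by linarith
  next
    case False
    have "x - p * (t - s) + b / 2 * (t\<^sup>2 - s\<^sup>2) = x + b / 2 * (t - p / b)\<^sup>2 - b / 2 * (s - p / b)\<^sup>2"
      using ab by (simp add: field_simps power2_eq_square)
    moreover have "0 \<le> b / 2 * (s - p / b)\<^sup>2" using ab by simp
    moreover have "x < - (b / 2) * (t - p / b)\<^sup>2" using mem False by (auto simp: Omega2_def)
    ultimately show ?thesis by linarith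
  qed
  show "f2 x t p a b = (p - b * t + a * (t - t)) * x - 1 / 2 * ((p ^ 3 - (p - b * t) ^ 3) / (3 * b)
        + ((p - b * t + a * (t - t)) ^ 3 - (p - b * t) ^ 3) / (3 * a))"
    using ab by (simp add: f2_def field_simps power2_eq_square power3_eq_cube)
qed (use ab t in \<open>auto simp: phase_curve_def algebra_simps\<close>)

lemma powr_three_halves: "0 \<le> z \<Longrightarrow> z powr (3 / 2) = sqrt z ^ 3" for z :: real
proof (cases "z = 0")
  case False
  assume "0 \<le> z"
  then have "0 < sqrt z" using False by simp
  have "z powr (3 / 2) = (z powr (1 / 2)) powr 3" by (simp add: powr_powr)
  also have "\<dots> = sqrt z powr 3" using \<open>0 \<le> z\<close> by (simp add: powr_half_sqrt)
  also have "\<dots> = sqrt z ^ 3" using \<open>0 < sqrt z\<close> by (simp add: powr_numeral)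
  finally show ?thesis .
qed simp

text \<open>The start \<open>- p\<^sup>2 / (2 * b)\<close> is the one from which deceleration
  \<open>b\<close> brings the curve to the origin with speed 0, at time \<alpha>. It rests there and
  leaves at \<open>t - q\<close>, where \<open>q\<close> is the time needed to reach
  \<open>x\<close> from rest with acceleration \<open>a\<close>. The bound on \<open>x\<close> in
  the region amounts to \<open>q < t - \<alpha>\<close>.\<close>

lemma Omega4_extremal:
  assumes ab: "0 < a" "0 < b" and t: "0 < t" and mem: "(x, t, p) \<in> Omega4 a b"
  shows "extremal_with_value a b t x p (\<lambda>s. if s < p / b then - (1 / (2 * b)) * (p - b * s)\<^sup>2
         else if s < t - sqrt (2 * x / a) then 0
         else a / 2 * (s - t + sqrt (2 * x / a))\<^sup>2) (f4 x t p a b)"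
proof -
  define q where "q = sqrt (2 * x / a)"
  define \<alpha> where "\<alpha> = p / b"
  have m: "0 \<le> p" "0 \<le> x" "x < a / 2 * (t - \<alpha>)\<^sup>2" "\<alpha> \<le> t" using mem by (auto simp: Omega4_def \<alpha>_def)
  have \<alpha>: "0 \<le> \<alpha>" "p = b * \<alpha>" using m ab by (auto simp: \<alpha>_def)
  have q: "0 \<le> q" "x = a / 2 * q\<^sup>2" using m ab by (auto simp: q_def)
  have "q\<^sup>2 < (t - \<alpha>)\<^sup>2" using m(3) ab unfolding q(2) by simp
  then have qt: "q < t - \<alpha>" using m(4) by (simp add: power_less_imp_less_base)
  have f4: "f4 x t p a b = a\<^sup>2 / 3 * q ^ 3 - p ^ 3 / (6 * b)"
    using m ab by (simp add: f4_def powr_three_halves q_def)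
  show ?thesis
    unfolding \<alpha>_def[symmetric] q_def[symmetric]
  proof (rule extremal_with_value_phase_curve[where \<alpha> = \<alpha> and \<beta> = "t - q" and c = a and z = "- p\<^sup>2 / (2 * b)"])
    show "f4 x t p a b = (p - b * \<alpha> + a * (t - (t - q))) * x - 1 / 2 * ((p ^ 3 - (p - b * \<alpha>) ^ 3) / (3 * b)
        + ((p - b * \<alpha> + a * (t - (t - q))) ^ 3 - (p - b * \<alpha>) ^ 3) / (3 * a))"
      using ab unfolding f4 unfolding q(2) \<alpha>(2) by (simp add: field_simps power2_eq_square power3_eq_cube)
    show "(if s < \<alpha> then - (1 / (2 * b)) * (p - b * s)\<^sup>2 else if s < t - q then 0 else a / 2 * (s - t + q)\<^sup>2) =
         phase_curve b a \<alpha> (t - q) p (- p\<^sup>2 / (2 * b)) s" if "s \<in> {0..t}" for s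
      using ab qt unfolding \<alpha>(2) phase_curve_def
      by (auto simp: field_simps power2_eq_square max_def)
  qed (use ab t qt q \<alpha> in auto)
qed

text \<open>As in \<open>Omega4_extremal\<close>, but the curve leaves the origin downwards, with
  final acceleration \<open>- b\<close>. The rest may have length 0, because the region includes its
  lower boundary.\<close>

lemma Omega5_extremal:
  assumes ab: "0 < a" "0 < b" and t: "0 < t" and mem: "(x, t, p) \<in> Omega5 a b"
  shows "extremal_with_value a b t x p (\<lambda>s. if s < p / b then - (1 / (2 * b)) * (p - b * s)\<^sup>2
         else if s < t - sqrt (2 * \<bar>x\<bar> / b) then 0
         else - (b / 2) * (s - t + sqrt (2 * \<bar>x\<bar> / b))\<^sup>2) (f5 x t p a b)"
proof -
  define q where "q = sqrt (2 * \<bar>x\<bar> / b)"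
  define \<alpha> where "\<alpha> = p / b"
  have m: "0 \<le> p" "x < 0" "- (b / 2) * (t - \<alpha>)\<^sup>2 \<le> x" "\<alpha> \<le> t" using mem by (auto simp: Omega5_def \<alpha>_def)
  have \<alpha>: "0 \<le> \<alpha>" "p = b * \<alpha>" using m ab by (auto simp: \<alpha>_def)
  have abs: "\<bar>x\<bar> = - x" using m by simp
  have nn: "0 \<le> 2 * \<bar>x\<bar> / b" using ab by simp
  then have q: "0 \<le> q" "q\<^sup>2 = 2 * \<bar>x\<bar> / b" by (simp_all add: q_def)
  then have x: "x = - (b / 2) * q\<^sup>2" using ab abs by (simp add: field_simps)
  have "q\<^sup>2 \<le> (t - \<alpha>)\<^sup>2" using m(3) ab unfolding x by simp
  then have qt: "q \<le> t - \<alpha>" by (rule power2_le_imp_le) (use m(4) in simp)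
  have f5: "f5 x t p a b = b\<^sup>2 / 3 * q ^ 3 - p ^ 3 / (6 * b)"
    using m ab nn unfolding f5_def q_def abs by (simp add: powr_three_halves)
  show ?thesis
    unfolding \<alpha>_def[symmetric] q_def[symmetric]
  proof (rule extremal_with_value_phase_curve[where \<alpha> = \<alpha> and \<beta> = "t - q" and c = "- b" and z = "- p\<^sup>2 / (2 * b)"])
    show "f5 x t p a b = (p - b * \<alpha> + - b * (t - (t - q))) * x - 1 / 2 * ((p ^ 3 - (p - b * \<alpha>) ^ 3) / (3 * b)
        + ((p - b * \<alpha> + - b * (t - (t - q))) ^ 3 - (p - b * \<alpha>) ^ 3) / (3 * - b))"
      using ab unfolding f5 unfolding x \<alpha>(2) by (simp add: field_simps power2_eq_square power3_eq_cube)
    show "(if s < \<alpha> then - (1 / (2 * b)) * (p - b * s)\<^sup>2 else if s < t - q then 0 else - (b / 2) * (s - t + q)\<^sup>2) =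
         phase_curve b (- b) \<alpha> (t - q) p (- p\<^sup>2 / (2 * b)) s" if "s \<in> {0..t}" for s
      using ab qt unfolding \<alpha>(2) phase_curve_def
      by (auto simp: field_simps power2_eq_square max_def)
  qed (use ab t qt q \<alpha> m in auto)
qed

text \<open>The curve crosses the origin at \<tau> with speed \<open>p - b * \<tau>\<close> and
  needs the time \<open>d = t - \<tau>\<close> to reach \<open>x\<close> with acceleration
  \<open>a\<close>. This is a quadratic equation for \<open>d\<close>, \<open>D\<close> is its
  reduced discriminant and the larger root is taken. The upper bound on \<open>x\<close> in the
  region gives \<open>0 < \<tau>\<close>, the lower bounds give \<open>0 \<le> d\<close> and a
  nonnegative crossing speed.\<close>

lemma Omega3_extremal:
  assumes ab: "0 < a" "0 < b" and t: "0 < t" and mem: "(x, t, p) \<in> Omega3 a b"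
  defines "\<tau> \<equiv> tau x t p a b"
  shows "extremal_with_value a b t x p (\<lambda>s. if s < \<tau> then - p * (\<tau> - s) + b / 2 * (\<tau>\<^sup>2 - s\<^sup>2)
         else (p - b * \<tau>) * (s - \<tau>) + a / 2 * (s - \<tau>)\<^sup>2) (f3 x t p a b)"
proof -
  define k where "k = a + 2 * b"
  have k: "0 < k" using ab by (simp add: k_def)
  define D where "D = (b * t - p)\<^sup>2 + 2 * x * k"
  define R where "R = sqrt D"
  have m: "0 \<le> p" "0 \<le> x" "x < p * t + a / 2 * t\<^sup>2"
    using mem ab by (auto simp: Omega3_def intro: order_trans[of 0 "a / 2 * (t - p / b)\<^sup>2"])
  have "0 \<le> 2 * x * k" using m k by simp
  then have D: "(b * t - p)\<^sup>2 \<le> D" by (simp add: D_def)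
  then have D0: "0 \<le> D" by (meson order_trans zero_le_power2)
  have R: "0 \<le> R" "R\<^sup>2 = D" using D0 by (auto simp: R_def)
  have \<tau>: "k * \<tau> = (a + b) * t + p - R"
  proof -
    have "2 * b + a = k" "2 * k * x = 2 * x * k" by (simp_all add: k_def)
    then have "\<tau> = ((a + b) * t + p - R) / k"
      unfolding \<tau>_def tau_def R_def D_def by simp
    then show ?thesis using k by simp
  qed
  define d where "d = t - \<tau>"
  have Rd: "R = k * d - (b * t - p)"
    using \<tau> by (simp add: d_def k_def algebra_simps)
  have "k * (2 * x) = R\<^sup>2 - (b * t - p)\<^sup>2" using R by (simp add: D_def)
  also have "\<dots> = k * (k * d\<^sup>2 - 2 * d * (b * t - p))"
    unfolding Rd by (simp add: power2_eq_square algebra_simps)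
  finally have "x = (k * d\<^sup>2 - 2 * d * (b * t - p)) / 2"
    unfolding mult_cancel_left using k by simp
  then have x: "x = (p - b * \<tau>) * d + a / 2 * d\<^sup>2"
    by (simp add: d_def k_def power2_eq_square field_simps)
  have "b * t - p \<le> R" "p - b * t \<le> R"
    using D R by (metis abs_le_square_iff abs_of_nonneg abs_le_iff minus_diff_eq)+
  then have "0 \<le> k * d" unfolding Rd by simp
  then have d: "0 \<le> d" using k by (simp add: zero_le_mult_iff)
  have "D < (b * t - p)\<^sup>2 + 2 * (p * t + a / 2 * t\<^sup>2) * k"
    using m k by (simp add: D_def)
  also have "\<dots> = ((a + b) * t + p)\<^sup>2"
    by (simp add: k_def power2_eq_square field_simps)
  finally have "R < (a + b) * t + p"
    using R ab t m by (metis add_nonneg_nonneg less_imp_le mult_nonneg_nonneg power_less_imp_less_base)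
  then have "0 < k * \<tau>" unfolding \<tau> by simp
  then have \<tau>0: "0 < \<tau>" using k by (simp add: zero_less_mult_iff)
  \<comment> \<open>The crossing speed times \<open>k\<close> is
    \<open>b * R - (a + b) * (b * t - p)\<close>. If \<open>b * t > p\<close>, comparing squares
    reduces its sign to the bound \<open>a / 2 * (t - p / b)\<^sup>2 \<le> x\<close>.\<close>
  have \<tau>p: "b * \<tau> \<le> p"
  proof -
    have "(a + b) * (b * t - p) \<le> b * R"
    proof (cases "b * t \<le> p")
      case True
      then have "(a + b) * (b * t - p) \<le> 0" using ab by (simp add: mult_nonneg_nonpos)
      also have "0 \<le> b * R" using ab R by simp
      finally show ?thesis .
    next
      case False
      then have "\<not> t < p / b" using ab by (simp add: field_simps)
      then have "a / 2 * (t - p / b)\<^sup>2 \<le> x" using mem by (auto simp: Omega3_def)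
      then have "a / 2 * (b * t - p)\<^sup>2 \<le> b\<^sup>2 * x"
        using ab by (simp add: field_simps power2_eq_square)
      then have le: "0 \<le> 2 * (k * (b\<^sup>2 * x) - k * (a / 2 * (b * t - p)\<^sup>2))"
        using k by (simp only: zero_le_mult_iff diff_ge_0_iff_ge mult_le_cancel_left) simp
      have "(b * R)\<^sup>2 - ((a + b) * (b * t - p))\<^sup>2
          = 2 * (k * (b\<^sup>2 * x) - k * (a / 2 * (b * t - p)\<^sup>2))"
        unfolding power_mult_distrib R D_def by (simp add: k_def power2_eq_square field_simps)
      then have "0 \<le> (b * R)\<^sup>2 - ((a + b) * (b * t - p))\<^sup>2" using le by (simp only:)
      then have "((a + b) * (b * t - p))\<^sup>2 \<le> (b * R)\<^sup>2" by (simp only: diff_ge_0_iff_ge)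
      then show ?thesis by (rule power2_le_imp_le) (use ab R in simp)
    qed
    moreover have "k * (p - b * \<tau>) = b * R - (a + b) * (b * t - p)"
    proof -
      have "k * (p - b * \<tau>) = k * p - b * (k * \<tau>)" by (simp add: algebra_simps)
      also have "\<dots> = b * R - (a + b) * (b * t - p)" unfolding \<tau> by (simp add: k_def algebra_simps)
      finally show ?thesis .
    qed
    ultimately have "0 \<le> k * (p - b * \<tau>)" by simp
    then show ?thesis using k by (simp add: zero_le_mult_iff)
  qed
  have f3: "f3 x t p a b = (a + b) / (3 * k\<^sup>2) * ((b * t - p) ^ 3 + R ^ 3) - b / k * (b * t - p) * x
     - b\<^sup>2 / 6 * t ^ 3 + b / 2 * p * t\<^sup>2 - 1 / 2 * p\<^sup>2 * t"
    unfolding f3_def k_def[symmetric] D_def[symmetric] R_def using D0 by (simp add: powr_three_halves)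
  show ?thesis
  proof (rule extremal_with_value_phase_curve[where \<alpha> = \<tau> and \<beta> = \<tau> and c = a and z = "- p * \<tau> + b / 2 * \<tau>\<^sup>2"])
    show "f3 x t p a b = (p - b * \<tau> + a * (t - \<tau>)) * x - 1 / 2 * ((p ^ 3 - (p - b * \<tau>) ^ 3) / (3 * b)
        + ((p - b * \<tau> + a * (t - \<tau>)) ^ 3 - (p - b * \<tau>) ^ 3) / (3 * a))"
    proof -
      define u where "u = b * t - p"
      have p: "p = b * t - u" and \<tau>d: "\<tau> = t - d" by (simp_all add: u_def d_def)
      \<comment> \<open>With \<open>u\<close> and \<open>d\<close> as variables the square root
        disappears. The cubes split into a multiple of \<open>k\<^sup>2\<close> and a multiple of
        \<open>k\<close>; after division by \<open>k\<^sup>2\<close> only one term with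
        \<open>1 / k\<close> remains, and it cancels against the term of \<open>f3\<close> that is
        linear in \<open>x\<close>.\<close>
      have cubes: "u ^ 3 + R ^ 3 = k\<^sup>2 * (k * d ^ 3 - 3 * d\<^sup>2 * u) + k * (3 * d * u\<^sup>2)"
        unfolding Rd u_def[symmetric] by (simp add: power2_eq_square power3_eq_cube algebra_simps)
      have 1: "(a + b) / (3 * k\<^sup>2) * (u ^ 3 + R ^ 3)
          = (a + b) * (k * d ^ 3 / 3 - d\<^sup>2 * u) + (a + b) * (d * u\<^sup>2) / k"
        unfolding cubes using k by (simp add: field_simps power2_eq_square)
      have xu: "x = (b * d - u) * d + a / 2 * d\<^sup>2"
        unfolding x by (simp add: p \<tau>d algebra_simps)
      have *: "(a + b) * (d * u\<^sup>2) - b * u * x = k * (d * u\<^sup>2 - b * d\<^sup>2 * u / 2)"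
        unfolding xu k_def by (simp add: power2_eq_square field_simps)
      have "(a + b) * (d * u\<^sup>2) / k - b / k * u * x = ((a + b) * (d * u\<^sup>2) - b * u * x) / k"
        by (simp add: diff_divide_distrib)
      also have "\<dots> = d * u\<^sup>2 - b * d\<^sup>2 * u / 2" unfolding * using k by simp
      finally have 2: "(a + b) * (d * u\<^sup>2) / k - b / k * u * x = d * u\<^sup>2 - b * d\<^sup>2 * u / 2" .
      have f3': "f3 x t p a b = (a + b) * (k * d ^ 3 / 3 - d\<^sup>2 * u) + (d * u\<^sup>2 - b * d\<^sup>2 * u / 2)
          - b\<^sup>2 / 6 * t ^ 3 + b / 2 * p * t\<^sup>2 - 1 / 2 * p\<^sup>2 * t"
        unfolding f3 u_def[symmetric] 1 using 2 by linarith
      show ?thesis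
        unfolding f3' unfolding xu k_def unfolding \<tau>d p using ab
        by (simp add: field_simps power2_eq_square power3_eq_cube)
    qed
    show "(if s < \<tau> then - p * (\<tau> - s) + b / 2 * (\<tau>\<^sup>2 - s\<^sup>2) else (p - b * \<tau>) * (s - \<tau>) + a / 2 * (s - \<tau>)\<^sup>2) =
         phase_curve b a \<tau> \<tau> p (- p * \<tau> + b / 2 * \<tau>\<^sup>2) s" if "s \<in> {0..t}" for s
      unfolding phase_curve_def by (auto simp: field_simps power2_eq_square)
    show "(if s < \<tau> then - p * (\<tau> - s) + b / 2 * (\<tau>\<^sup>2 - s\<^sup>2) else (p - b * \<tau>) * (s - \<tau>) + a / 2 * (s - \<tau>)\<^sup>2) \<le> 0"
      if s: "0 \<le> s" "s < \<tau>" for s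
    proof -
      have "b * ((\<tau> + s) / 2) \<le> b * \<tau>" using s ab by (intro mult_left_mono) auto
      then have "0 \<le> (p - b * ((\<tau> + s) / 2)) * (\<tau> - s)" using \<tau>p s by simp
      moreover have "- p * (\<tau> - s) + b / 2 * (\<tau>\<^sup>2 - s\<^sup>2) = - ((p - b * ((\<tau> + s) / 2)) * (\<tau> - s))"
        by (simp add: field_simps power2_eq_square)
      ultimately show ?thesis using s by simp
    qed
    show "0 \<le> a * (if s < \<tau> then - p * (\<tau> - s) + b / 2 * (\<tau>\<^sup>2 - s\<^sup>2) else (p - b * \<tau>) * (s - \<tau>) + a / 2 * (s - \<tau>)\<^sup>2)"
      if s: "\<tau> < s" "s \<le> t" for s
      using s \<tau>p ab by simp
  qed (use ab t d \<tau>0 x in \<open>auto simp: d_def\<close>)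
qed

lemma gamma_scalar_extremal:
  assumes "0 < a" "0 < b" and t: "0 < t"
  shows "extremal_with_value a b t x p (\<lambda>s. gamma_scalar s x t p a b) (V_scalar x t p a b)"
proof -
  have main: "extremal_with_value a b t x p (\<lambda>s. gamma_nonneg s x t p a b) (V_nonneg x t p a b)"
    if ab: "0 < a" "0 < b" and p: "0 \<le> p" for x p a b
  proof -
    \<comment> \<open>That the regions cover everything rules out the \<open>undefined\<close>
      branch.\<close>
    have "(x, t, p) \<in> Omega1 a b \<union> Omega2 a b \<union> Omega3 a b \<union> Omega4 a b \<union> Omega5 a b"
      using t p unfolding Omega1_def Omega2_def Omega3_def Omega4_def Omega5_def by auto
    then show ?thesis
      unfolding gamma_nonneg_def V_nonneg_def Let_def
      using Omega1_extremal[OF ab t] Omega2_extremal[OF ab t] Omega3_extremal[OF ab t]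
        Omega4_extremal[OF ab t] Omega5_extremal[OF ab t] by auto
  qed
  show ?thesis
  proof (cases "0 \<le> p")
    case True
    then show ?thesis using main[of a b p x] assms by (simp add: gamma_scalar_def V_scalar_def)
  next
    case False
    then show ?thesis
      using main[of b a "- p" "- x"] assms
      by (auto simp: gamma_scalar_def V_scalar_def intro!: extremal_with_value_uminus)
  qed
qed

subsection \<open>Convex duality\<close>

text \<open>A hyperplane separates the graph point over \<open>z\<^sub>0\<close> from the strict
  epigraph. It is not vertical because the function is finite everywhere, so it can be solved for
  the last coordinate.\<close>

lemma convex_on_subgradient:
  fixes \<Psi> :: "'a::euclidean_space \<Rightarrow> real"
  assumes conv: "convex_on UNIV \<Psi>"
  obtains q where "\<And>z. \<Psi> z\<^sub>0 + q \<bullet> (z - z\<^sub>0) \<le> \<Psi> z"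
proof -
  define E where "E = {(z, r). \<Psi> z < r}"
  have "convex E"
    unfolding convex_def E_def
  proof clarsimp
    fix z z' r r' and u v :: real
    assume *: "\<Psi> z < r" "\<Psi> z' < r'" "0 \<le> u" "0 \<le> v" "u + v = 1"
    have "\<Psi> (u *\<^sub>R z + v *\<^sub>R z') \<le> u * \<Psi> z + v * \<Psi> z'"
      using conv * by (auto simp: convex_on_def)
    also have "\<dots> < u * r + v * r'"
    proof (cases "u = 0")
      case False
      then have "u * \<Psi> z < u * r" "v * \<Psi> z' \<le> v * r'" using * by (auto intro: mult_left_mono)
      then show ?thesis by simp
    qed (use * in simp)
    finally show "\<Psi> (u *\<^sub>R z + v *\<^sub>R z') < u * r + v * r'" .
  qed
  moreover have "(0, \<Psi> 0 + 1) \<in> E"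
    by (simp add: E_def)
  then have "E \<noteq> {}" by blast
  moreover have "{(z\<^sub>0, \<Psi> z\<^sub>0)} \<inter> E = {}"
    by (auto simp: E_def)
  ultimately obtain n \<beta> where n: "n \<noteq> 0" "n \<bullet> (z\<^sub>0, \<Psi> z\<^sub>0) \<le> \<beta>" "\<And>y. y \<in> E \<Longrightarrow> \<beta> \<le> n \<bullet> y"
    using separating_hyperplane_sets[of "{(z\<^sub>0, \<Psi> z\<^sub>0)}" E] by (metis convex_singleton insertI1 insert_not_empty)
  obtain w c where wc: "n = (w, c)" by (cases n)
  have sep: "w \<bullet> z\<^sub>0 + c * \<Psi> z\<^sub>0 \<le> w \<bullet> z + c * r" if "\<Psi> z < r" for z r
    using n(2) n(3)[of "(z, r)"] that by (auto simp: wc E_def)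
  have "0 < c"
  proof (rule ccontr)
    assume "\<not> 0 < c"
    moreover have "0 \<le> c"
      using sep[of z\<^sub>0 "\<Psi> z\<^sub>0 + 1"] by (simp add: distrib_left)
    ultimately have "c = 0" by simp
    \<comment> \<open>For a vertical hyperplane the point \<open>z\<^sub>0 - w\<close>, which also
      has epigraph points above it, lies on the wrong side unless \<open>w = 0\<close>.\<close>
    then have "w \<bullet> w \<le> 0"
      using sep[of "z\<^sub>0 - w" "\<Psi> (z\<^sub>0 - w) + 1"] by (simp add: inner_diff_right)
    then have "w = 0" by (metis inner_eq_zero_iff inner_ge_zero order_antisym)
    then show False using n(1) wc \<open>c = 0\<close> by (simp add: zero_prod_def)
  qed
  have "w \<bullet> z\<^sub>0 + c * \<Psi> z\<^sub>0 \<le> w \<bullet> z + c * \<Psi> z" for z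
  proof (rule field_le_epsilon)
    fix e :: real assume "0 < e"
    then show "w \<bullet> z\<^sub>0 + c * \<Psi> z\<^sub>0 \<le> w \<bullet> z + c * \<Psi> z + e"
      using sep[of z "\<Psi> z + e / c"] \<open>0 < c\<close> by (simp add: distrib_left)
  qed
  then have "\<Psi> z\<^sub>0 + (- (1 / c) *\<^sub>R w) \<bullet> (z - z\<^sub>0) \<le> \<Psi> z" for z
    using \<open>0 < c\<close> by (simp add: inner_diff_right field_simps)
  then show thesis by (rule that)
qed

lemma legendre_fenchel_ge: "ereal (p \<bullet> z - g z) \<le> legendre_fenchel g p"
  unfolding legendre_fenchel_def by (rule SUP_upper) simp

lemma legendre_fenchel_le_iff: "legendre_fenchel g p \<le> ereal c \<longleftrightarrow> (\<forall>z. p \<bullet> z - g z \<le> c)"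
  by (simp add: legendre_fenchel_def SUP_le_iff)

lemma legendre_fenchel_subgradient:
  assumes "\<And>z. g z\<^sub>0 + q \<bullet> (z - z\<^sub>0) \<le> g z"
  shows "legendre_fenchel g q = ereal (q \<bullet> z\<^sub>0 - g z\<^sub>0)"
proof (rule antisym)
  show "legendre_fenchel g q \<le> ereal (q \<bullet> z\<^sub>0 - g z\<^sub>0)"
    unfolding legendre_fenchel_le_iff using assms by (auto simp: inner_diff_right algebra_simps)
qed (rule legendre_fenchel_ge)

text \<open>\<open>g p\<close> is the gradient of the concave function \<open>G\<close> at \<open>p\<close>, so at a maximum of \<open>G\<close> minus the conjugate
  of \<open>\<Psi>\<close> it is a subgradient of that conjugate. Equality in the Fenchel--Young inequality follows from
  comparing with a subgradient of \<open>\<Psi>\<close> at \<open>g p\<close>.\<close>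

lemma conjugate_dual_maximum:
  fixes \<Psi> G :: "'a::euclidean_space \<Rightarrow> real" and g :: "'a \<Rightarrow> 'a"
  assumes conv: "convex_on UNIV \<Psi>"
    and super: "\<And>p q. G q \<le> G p + (q - p) \<bullet> g p"
    and lip: "\<And>p q. norm (g q - g p) \<le> T * norm (q - p)"
    and coercive: "\<And>p. G p \<le> K - norm p"
  shows "\<exists>p. ereal (G p) - legendre_fenchel \<Psi> p = (SUP q. ereal (G q) - legendre_fenchel \<Psi> q)"
    and "\<And>p. ereal (G p) - legendre_fenchel \<Psi> p = (SUP q. ereal (G q) - legendre_fenchel \<Psi> q) \<Longrightarrow>
      legendre_fenchel \<Psi> p = ereal (p \<bullet> g p - \<Psi> (g p))"
proof -
  define F where "F q = ereal (G q) - legendre_fenchel \<Psi> q" for q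
  have F_le: "F q \<le> ereal (G q - q \<bullet> z + \<Psi> z)" for q z
    using legendre_fenchel_ge[of q z \<Psi>] unfolding F_def
    by (cases "legendre_fenchel \<Psi> q") auto
  \<comment> \<open>At a subgradient of \<Psi> at 0 the conjugate is finite, so the supremum is not
    minus infinity; coercivity bounds it from above.\<close>
  obtain p\<^sub>0 where "\<And>z. \<Psi> 0 + p\<^sub>0 \<bullet> (z - 0) \<le> \<Psi> z"
    using convex_on_subgradient[OF conv] by blast
  then have p0: "F p\<^sub>0 = ereal (G p\<^sub>0 + \<Psi> 0)"
    unfolding F_def by (subst legendre_fenchel_subgradient[of \<Psi> 0]) auto
  have "(SUP q. F q) \<le> ereal (K + \<Psi> 0)"
  proof (rule SUP_least)
    fix q
    have "G q - q \<bullet> 0 + \<Psi> 0 \<le> K + \<Psi> 0" using coercive[of q] norm_ge_zero[of q] unfolding inner_zero_right by linarith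
    then show "F q \<le> ereal (K + \<Psi> 0)" using F_le[of q 0] by (metis ereal_less_eq(3) order_trans)
  qed
  moreover have "ereal (G p\<^sub>0 + \<Psi> 0) \<le> (SUP q. F q)"
    using SUP_upper[of p\<^sub>0 UNIV F] p0 by simp
  ultimately obtain \<sigma> where \<sigma>: "(SUP q. F q) = ereal \<sigma>"
    by (cases "SUP q. F q") auto
  have F_\<sigma>: "F q \<le> ereal \<sigma>" for q
    using SUP_upper[of q UNIV F] \<sigma> by simp
  show "\<exists>p. ereal (G p) - legendre_fenchel \<Psi> p = (SUP q. ereal (G q) - legendre_fenchel \<Psi> q)"
  proof -
    \<comment> \<open>Direct method: a maximising sequence is bounded by coercivity. In the limit
      \<open>super\<close> at \<open>l\<close> bounds \<open>G\<close> from above, while the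
      conjugate is handled through its defining inequality at each fixed \<open>z\<close>.\<close>
    have "\<exists>p. ereal (\<sigma> - inverse (real (Suc n))) < F p" for n
      using less_SUP_iff[of "ereal (\<sigma> - inverse (real (Suc n)))" F UNIV] \<sigma> by auto
    then obtain p where p: "\<And>n. ereal (\<sigma> - inverse (real (Suc n))) < F (p n)" by metis
    have p_le: "\<sigma> - inverse (real (Suc n)) \<le> G (p n) - p n \<bullet> z + \<Psi> z" for n z
      using p[of n] F_le[of "p n" z] by (metis ereal_less_eq(3) less_imp_le order_trans)
    have "norm (p n) \<le> K + \<Psi> 0 - \<sigma> + 1" for n
    proof -
      have "inverse (real (Suc n)) \<le> 1" by (simp add: inverse_le_1_iff)
      then show ?thesis using p_le[of n 0] coercive[of "p n"] by simp
    qed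
    then have "bounded (range p)" by (auto simp: bounded_iff)
    then obtain l r where r: "strict_mono (r :: nat \<Rightarrow> nat)" and l: "(p \<circ> r) \<longlonglongrightarrow> l"
      using bounded_imp_convergent_subsequence by blast
    have "l \<bullet> z - \<Psi> z \<le> G l - \<sigma>" for z
    proof -
      have "\<sigma> - 0 \<le> G l + (l - l) \<bullet> g l - l \<bullet> z + \<Psi> z"
      proof (rule LIMSEQ_le)
        show "(\<lambda>n. \<sigma> - inverse (real (Suc (r n)))) \<longlonglongrightarrow> \<sigma> - 0"
          by (intro tendsto_intros LIMSEQ_subseq_LIMSEQ[OF LIMSEQ_inverse_real_of_nat r, unfolded o_def])
        show "(\<lambda>n. G l + (p (r n) - l) \<bullet> g l - p (r n) \<bullet> z + \<Psi> z) \<longlonglongrightarrow> G l + (l - l) \<bullet> g l - l \<bullet> z + \<Psi> z"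
          using l by (intro tendsto_intros) (auto simp: o_def)
        show "\<exists>N. \<forall>n\<ge>N. \<sigma> - inverse (real (Suc (r n))) \<le> G l + (p (r n) - l) \<bullet> g l - p (r n) \<bullet> z + \<Psi> z"
        proof (intro exI allI impI)
          fix n
          show "\<sigma> - inverse (real (Suc (r n))) \<le> G l + (p (r n) - l) \<bullet> g l - p (r n) \<bullet> z + \<Psi> z"
            using p_le[of "r n" z] super[of "p (r n)" l] by linarith
        qed
      qed
      then show ?thesis by simp
    qed
    then have "legendre_fenchel \<Psi> l \<le> ereal (G l - \<sigma>)"
      by (simp add: legendre_fenchel_le_iff)
    then have "ereal \<sigma> \<le> F l"
      unfolding F_def using legendre_fenchel_ge[of l 0 \<Psi>]
      by (cases "legendre_fenchel \<Psi> l") auto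
    then have "F l = (SUP q. F q)" using F_\<sigma> \<sigma> by (simp add: antisym)
    then show ?thesis by (auto simp: F_def)
  qed
  fix p assume "ereal (G p) - legendre_fenchel \<Psi> p = (SUP q. ereal (G q) - legendre_fenchel \<Psi> q)"
  then have "ereal (G p) - legendre_fenchel \<Psi> p = ereal \<sigma>" using \<sigma> by (simp add: F_def)
  then obtain \<kappa> where \<kappa>: "legendre_fenchel \<Psi> p = ereal \<kappa>" "\<sigma> = G p - \<kappa>"
    by (cases "legendre_fenchel \<Psi> p") auto
  obtain q where q: "\<And>z. \<Psi> (g p) + q \<bullet> (z - g p) \<le> \<Psi> z"
    using convex_on_subgradient[OF conv] by blast
  define \<mu> where "\<mu> = q \<bullet> g p - \<Psi> (g p)"
  have \<mu>: "legendre_fenchel \<Psi> q = ereal \<mu>"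
    unfolding \<mu>_def by (rule legendre_fenchel_subgradient[OF q])
  \<comment> \<open>Maximality is compared with the point at fraction \<open>e\<close> of the way
    from \<open>p\<close> to \<open>q\<close>, where convexity bounds the conjugate. The
    supergradient inequality yields the gradient at that point; replacing it by \<open>g p\<close>
    costs the error with factor \<open>T * e\<close>, which vanishes as \<open>e\<close> tends to
    0.\<close>
  have bound: "(q - p) \<bullet> g p \<le> \<mu> - \<kappa> + T * e * (norm (q - p))\<^sup>2" if e: "0 < e" "e < 1" for e
  proof -
    define r where "r = p + e *\<^sub>R (q - p)"
    have "r \<bullet> z - \<Psi> z \<le> (1 - e) * \<kappa> + e * \<mu>" for z
    proof -
      have "p \<bullet> z - \<Psi> z \<le> \<kappa>" "q \<bullet> z - \<Psi> z \<le> \<mu>"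
        using legendre_fenchel_ge[of p z \<Psi>] legendre_fenchel_ge[of q z \<Psi>] \<kappa> \<mu> by simp_all
      then have "(1 - e) * (p \<bullet> z - \<Psi> z) + e * (q \<bullet> z - \<Psi> z) \<le> (1 - e) * \<kappa> + e * \<mu>"
        using e by (intro add_mono mult_left_mono) auto
      then show ?thesis by (simp add: r_def inner_simps algebra_simps)
    qed
    then have "legendre_fenchel \<Psi> r \<le> ereal ((1 - e) * \<kappa> + e * \<mu>)"
      by (simp add: legendre_fenchel_le_iff)
    then have "G r - ((1 - e) * \<kappa> + e * \<mu>) \<le> \<sigma>"
      using F_\<sigma>[of r] legendre_fenchel_ge[of r 0 \<Psi>] unfolding F_def
      by (cases "legendre_fenchel \<Psi> r") auto
    then have "G r - G p \<le> e * (\<mu> - \<kappa>)"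
      using \<kappa> by (simp add: algebra_simps)
    moreover have "e * ((q - p) \<bullet> g r) \<le> G r - G p"
      using super[of p r] by (simp add: r_def)
    ultimately have "e * ((q - p) \<bullet> g r) \<le> e * (\<mu> - \<kappa>)" by linarith
    then have 1: "(q - p) \<bullet> g r \<le> \<mu> - \<kappa>" using e by simp
    have "(q - p) \<bullet> (g p - g r) \<le> norm (q - p) * norm (g p - g r)"
      by (rule norm_cauchy_schwarz)
    also have "\<dots> \<le> norm (q - p) * (T * norm (p - r))"
      by (intro mult_left_mono lip) simp
    also have "\<dots> = T * e * (norm (q - p))\<^sup>2"
      using e by (simp add: r_def power2_eq_square)
    finally show ?thesis using 1 by (simp add: inner_diff_right)
  qed
  have "(q - p) \<bullet> g p \<le> \<mu> - \<kappa> + T * 0 * (norm (q - p))\<^sup>2"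
  proof (rule tendsto_lowerbound)
    show "((\<lambda>e. \<mu> - \<kappa> + T * e * (norm (q - p))\<^sup>2) \<longlongrightarrow> \<mu> - \<kappa> + T * 0 * (norm (q - p))\<^sup>2) (at_right 0)"
      by (intro tendsto_intros)
    show "\<forall>\<^sub>F e in at_right 0. (q - p) \<bullet> g p \<le> \<mu> - \<kappa> + T * e * (norm (q - p))\<^sup>2"
      unfolding eventually_at_right_field using bound by (intro exI[of _ 1]) auto
  qed simp
  then have "\<kappa> \<le> p \<bullet> g p - \<Psi> (g p)"
    by (simp add: \<mu>_def inner_diff_left)
  moreover have "p \<bullet> g p - \<Psi> (g p) \<le> \<kappa>"
    using legendre_fenchel_ge[of p "g p" \<Psi>] \<kappa> by simp
  ultimately show "legendre_fenchel \<Psi> p = ereal (p \<bullet> g p - \<Psi> (g p))"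
    using \<kappa> by simp
qed

subsection \<open>Reduction to scalar problems\<close>

lemma matrix_inv_mult_vector:
  fixes P :: "real^'n^'n"
  assumes "invertible P"
  shows "P *v (matrix_inv P *v x) = x" "matrix_inv P *v (P *v x) = x"
proof -
  have "P ** matrix_inv P = mat 1 \<and> matrix_inv P ** P = mat 1"
    using assms unfolding matrix_inv_def invertible_def by (rule someI_ex)
  then show "P *v (matrix_inv P *v x) = x" "matrix_inv P *v (P *v x) = x"
    by (simp_all add: matrix_vector_mul_assoc)
qed

text \<open>Applied to \<open>P *v w\<close>, the inverse of \<open>M\<close> gives the transposed
  inverse of \<open>P\<close> applied to \<open>w\<close>, so the weighted norm is Euclidean in the
  new coordinates.\<close>

lemma weighted_norm_matrix_inv:
  fixes P M :: "real^'n^'n"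
  assumes P: "invertible P" and M: "M = P ** transpose P"
  shows "(weighted_norm (matrix_inv M) (P *v w))\<^sup>2 = (\<Sum>i\<in>UNIV. (w $ i)\<^sup>2)"
proof -
  have inv: "invertible M" "invertible (transpose P)"
    using P unfolding M by (auto intro: invertible_mult transpose_invertible)
  have inv_P: "P ** matrix_inv P = mat 1" "matrix_inv P ** P = mat 1"
    using matrix_inv_mult_vector[OF P] by (simp_all add: matrix_eq matrix_vector_mul_assoc[symmetric])
  have "transpose P ** transpose (matrix_inv P) = transpose (matrix_inv P ** P)"
    by (simp add: matrix_transpose_mul)
  then have t: "transpose P ** transpose (matrix_inv P) = mat 1"
    using inv_P by (simp add: transpose_mat)
  have "M *v (transpose (matrix_inv P) *v w) = P *v ((transpose P ** transpose (matrix_inv P)) *v w)"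
    unfolding M by (simp only: matrix_vector_mul_assoc matrix_mul_assoc)
  then have "M *v (transpose (matrix_inv P) *v w) = P *v w" by (simp add: t)
  then have "matrix_inv M *v (P *v w) = transpose (matrix_inv P) *v w"
    by (metis matrix_inv_mult_vector(2)[OF inv(1)])
  then have "(P *v w) \<bullet> (matrix_inv M *v (P *v w)) = w \<bullet> (matrix_inv P *v (P *v w))"
    by (metis dot_lmul_matrix inner_commute transpose_matrix_vector)
  also have "\<dots> = w \<bullet> w" by (simp add: matrix_inv_mult_vector[OF P])
  finally have "(weighted_norm (matrix_inv M) (P *v w))\<^sup>2 = w \<bullet> w"
    by (simp add: weighted_norm_def)
  then show ?thesis by (simp add: inner_vec_def power2_eq_square)
qed

section \<open>The potential as a gauge of the cross-polytope\<close>

definition total_potential :: "real^'n \<Rightarrow> real^'n \<Rightarrow> real^'n \<Rightarrow> real" where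
  "total_potential a b y = (\<Sum>i\<in>UNIV. potential (a $ i) (b $ i) (y $ i))"

lemma potential_scale: "0 \<le> r \<Longrightarrow> potential a b (r * z) = r * potential a b z"
  by (cases "r = 0") (auto simp: potential_def zero_le_mult_iff)

lemma total_potential_scale: "0 \<le> r \<Longrightarrow> total_potential a b (r *\<^sub>R y) = r * total_potential a b y"
  by (simp add: total_potential_def potential_scale sum_distrib_left)

lemma potential_nonneg: "0 < a \<Longrightarrow> 0 < b \<Longrightarrow> 0 \<le> potential a b z"
  by (auto simp: potential_def mult_nonneg_nonpos)

lemma total_potential_convex:
  assumes "\<And>j. 0 < a $ j" "\<And>j. 0 < b $ j" "0 \<le> u" "0 \<le> v"
  shows "total_potential a b (u *\<^sub>R y + v *\<^sub>R z) \<le> u * total_potential a b y + v * total_potential a b z"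
proof -
  have "potential (a $ i) (b $ i) (u * y $ i + v * z $ i)
      \<le> u * potential (a $ i) (b $ i) (y $ i) + v * potential (a $ i) (b $ i) (z $ i)" for i
  proof -
    \<comment> \<open>The slope that is active at the combined point: there the potential is linear
      with slope \<open>w\<close>, elsewhere this linear function is a lower bound.\<close>
    define w where "w = (if 0 \<le> u * y $ i + v * z $ i then a $ i else - b $ i)"
    have w: "- b $ i \<le> w" "w \<le> a $ i"
      using assms(1)[of i] assms(2)[of i] by (auto simp: w_def)
    have "potential (a $ i) (b $ i) (u * y $ i + v * z $ i) = u * (w * y $ i) + v * (w * z $ i)"
      by (simp add: potential_def w_def algebra_simps)
    also have "\<dots> \<le> u * potential (a $ i) (b $ i) (y $ i) + v * potential (a $ i) (b $ i) (z $ i)"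
      using assms w by (intro add_mono mult_left_mono potential_ge) auto
    finally show ?thesis .
  qed
  then show ?thesis
    unfolding total_potential_def sum_distrib_left sum.distrib[symmetric]
    by (intro sum_mono) simp
qed

text \<open>Two nonnegative positively homogeneous functions with the same unit sublevel set agree.\<close>

lemma concave_one_homogeneous_eq_total_potential:
  fixes U :: "real^'n \<Rightarrow> real" and P :: "real^'n^'n"
  assumes U: "\<And>x. U x \<le> 0" and hom: "one_homogeneous (\<lambda>x. U (x + u0))"
    and P: "invertible P" and a: "\<And>j. a $ j > 0" and b: "\<And>j. b $ j > 0"
    and level: "{x. U (x + u0) \<ge> -1} =
         convex hull (\<Union>j. {(1 / a $ j) *\<^sub>R column j P, - (1 / b $ j) *\<^sub>R column j P})"
  shows "U (P *v y + u0) = - total_potential a b y"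
proof -
  let ?S = "\<Union>j. {(1 / a $ j) *\<^sub>R column j P, - (1 / b $ j) *\<^sub>R column j P}"
  define g where "g y = - U (P *v y + u0)" for y
  have g_scale: "g (r *\<^sub>R y) = r * g y" if "0 \<le> r" for r y
    using hom that by (simp add: one_homogeneous_def g_def matrix_vector_mult_scaleR)
  have g0: "0 \<le> g y" for y using U by (simp add: g_def)
  have p0: "0 \<le> total_potential a b y" for y
    using a b by (simp add: total_potential_def sum_nonneg potential_nonneg)
  have g_level: "g y \<le> 1 \<longleftrightarrow> P *v y \<in> convex hull ?S" for y
    unfolding level[symmetric] by (auto simp: g_def)
  have axis_pot: "total_potential a b (r *\<^sub>R axis j 1) = potential (a $ j) (b $ j) r" for r j
  proof -
    have "total_potential a b (r *\<^sub>R axis j 1)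
        = (\<Sum>i\<in>UNIV. if i = j then potential (a $ i) (b $ i) r else 0)"
      unfolding total_potential_def by (intro sum.cong) (auto simp: axis_def potential_def)
    then show ?thesis by simp
  qed
  have col: "column j P = P *v axis j 1" for j by (simp add: matrix_vector_mult_basis)
  have le1: "total_potential a b y \<le> 1" if gy: "g y \<le> 1" for y
  proof -
    \<comment> \<open>The right-hand side is convex, so only the vertices need checking, and they
      all have potential exactly 1.\<close>
    have "convex hull ?S \<subseteq> (\<lambda>y. P *v y) ` {y. total_potential a b y \<le> 1}"
    proof (rule hull_minimal)
      have "P *v (r *\<^sub>R axis j 1) \<in> (\<lambda>y. P *v y) ` {y. total_potential a b y \<le> 1}"
        if "r = 1 / a $ j \<or> r = - (1 / b $ j)" for r j
        using that a[of j] b[of j] by (intro imageI) (auto simp: axis_pot potential_def)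
      then show "?S \<subseteq> (\<lambda>y. P *v y) ` {y. total_potential a b y \<le> 1}"
        unfolding col matrix_vector_mult_scaleR[symmetric] by blast
      have "convex {y. total_potential a b y \<le> 1}"
        unfolding convex_def
      proof clarsimp
        fix x y u v assume *: "total_potential a b x \<le> 1" "total_potential a b y \<le> 1"
          "0 \<le> u" "0 \<le> v" "u + v = (1::real)"
        have "u * total_potential a b x + v * total_potential a b y \<le> u * 1 + v * 1"
          using * by (intro add_mono mult_left_mono) auto
        then show "total_potential a b (u *\<^sub>R x + v *\<^sub>R y) \<le> 1"
          using total_potential_convex[of a b u v x y] a b * by simp
      qed
      then show "convex ((\<lambda>y. P *v y) ` {y. total_potential a b y \<le> 1})"
        by (rule convex_linear_image[OF matrix_vector_mul_linear])
    qed
    then have "P *v y \<in> (\<lambda>y. P *v y) ` {y. total_potential a b y \<le> 1}"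
      using gy[unfolded g_level] by (rule subsetD)
    then obtain z where "P *v y = P *v z" "total_potential a b z \<le> 1"
      by auto
    then show ?thesis by (metis matrix_inv_mult_vector(2)[OF P])
  qed
  have ge1: "g y \<le> 1" if y: "total_potential a b y = 1" for y
  proof -
    \<comment> \<open>The scalar potentials are nonnegative and sum to 1; they are the barycentric
      weights of \<open>P *v y\<close> with respect to the vertices \<open>h i\<close> on the sides
      given by the signs of \<open>y\<close>.\<close>
    define w where "w i = potential (a $ i) (b $ i) (y $ i)" for i
    define h where "h i = (if 0 \<le> y $ i then (1 / a $ i) *\<^sub>R column i P else - (1 / b $ i) *\<^sub>R column i P)" for i
    have wh: "w i *\<^sub>R h i = y $ i *s column i P" for i
      using a[of i] b[of i] by (simp add: w_def h_def potential_def scalar_mult_eq_scaleR)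
    have "(\<Sum>i\<in>UNIV. w i *\<^sub>R h i) \<in> convex hull ?S"
    proof (rule convex_sum)
      show "(\<Sum>i\<in>UNIV. w i) = 1" using y by (simp add: w_def total_potential_def)
      show "h i \<in> convex hull ?S" for i
        by (rule hull_inc) (auto simp: h_def)
    qed (use a b in \<open>auto simp: w_def potential_nonneg\<close>)
    moreover have "(\<Sum>i\<in>UNIV. w i *\<^sub>R h i) = P *v y"
      unfolding wh by (rule matrix_mult_sum[symmetric])
    ultimately show ?thesis by (simp add: g_level)
  qed
  have "total_potential a b y \<le> g y"
  \<comment> \<open>Scaling by \<open>g y + e\<close> keeps the divisor positive even if
    \<open>g y = 0\<close>.\<close>
  proof (rule field_le_epsilon)
    fix e :: real assume e: "0 < e"
    have pos: "0 < g y + e" using g0[of y] e by simp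
    have "g ((1 / (g y + e)) *\<^sub>R y) \<le> 1"
      using pos e by (simp add: g_scale)
    then have "total_potential a b ((1 / (g y + e)) *\<^sub>R y) \<le> 1" by (rule le1)
    then show "total_potential a b y \<le> g y + e"
      using pos by (simp add: total_potential_scale)
  qed
  moreover have "g y \<le> total_potential a b y"
  proof (cases "total_potential a b y = 0")
    case True
    then have "potential (a $ i) (b $ i) (y $ i) = 0" for i
      using a b unfolding total_potential_def
      by (subst (asm) sum_nonneg_eq_0_iff) (auto simp: potential_nonneg)
    then have "y $ i = 0" for i
      using a[of i] b[of i] by (metis mult_eq_0_iff neg_equal_0_iff_equal order_less_irrefl potential_def)
    then have "y = 0" by (simp add: vec_eq_iff)
    then show ?thesis using g_scale[of 0 0] True by simp
  next
    case False
    then have pos: "0 < total_potential a b y" using p0[of y] by simp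
    have "g ((1 / total_potential a b y) *\<^sub>R y) \<le> 1"
      using pos by (intro ge1) (simp add: total_potential_scale)
    then show ?thesis using pos by (simp add: g_scale)
  qed
  ultimately show ?thesis by (simp add: g_def)
qed

text \<open>The integrands agree at almost every time, namely wherever all coordinates are
  differentiable; there \<open>X\<close> is differentiated as a combination of the columns of
  \<open>P\<close>.\<close>

lemma cost_eq_sum_running_cost:
  fixes X :: "real \<Rightarrow> real^'n" and P M :: "real^'n^'n"
  assumes P: "invertible P" and M: "M = P ** transpose P"
    and U: "\<And>y. U (P *v y + u0) = - total_potential a b y"
    and lip: "L-lipschitz_on {0..t} X" and t: "0 < t"
  defines "Y \<equiv> \<lambda>i s. (matrix_inv P *v (X s - u0)) $ i"
  shows "\<exists>K. \<forall>i. K-lipschitz_on {0..t} (Y i)"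
    and "cost M U \<Phi> t X = (\<Sum>i\<in>UNIV. running_cost (a $ i) (b $ i) t (Y i)) + \<Phi> (X 0)"
proof -
  let ?M = "lebesgue_on {0..t}"
  define K where "K = onorm (\<lambda>v. matrix_inv P *v v) * L"
  have Y_lip: "K-lipschitz_on {0..t} (Y i)" for i
  proof (rule lipschitz_onI)
    have bl: "bounded_linear (\<lambda>v. matrix_inv P *v v)" by simp
    show "0 \<le> K" using lipschitz_on_nonneg[OF lip] onorm_pos_le[OF bl] by (simp add: K_def)
    fix r s assume rs: "r \<in> {0..t}" "s \<in> {0..t}"
    have "dist (Y i r) (Y i s) = \<bar>(matrix_inv P *v (X r - X s)) $ i\<bar>"
      by (simp add: Y_def dist_real_def matrix_vector_mult_diff_distrib)
    also have "\<dots> \<le> norm (matrix_inv P *v (X r - X s))" by (rule component_le_norm_cart)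
    also have "\<dots> \<le> onorm (\<lambda>v. matrix_inv P *v v) * norm (X r - X s)" by (rule onorm[OF bl])
    also have "\<dots> \<le> onorm (\<lambda>v. matrix_inv P *v v) * (L * dist r s)"
      using lipschitz_onD[OF lip rs] onorm_pos_le[OF bl] by (intro mult_left_mono) (auto simp: dist_norm)
    finally show "dist (Y i r) (Y i s) \<le> K * dist r s" by (simp add: K_def mult.assoc)
  qed
  then show "\<exists>K. \<forall>i. K-lipschitz_on {0..t} (Y i)" by blast
  have X: "X s = P *v (\<chi> i. Y i s) + u0" for s
    by (simp add: Y_def matrix_inv_mult_vector[OF P])
  have "AE s in ?M. \<forall>i. 0 < s \<and> s < t \<and> (Y i has_real_derivative speed t (Y i) s) (at s)"
    using lipschitz_lebesgue_vector_derivative(1)[OF Y_lip t]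
    by (subst AE_all_countable) (auto simp: speed_def elim: eventually_mono)
  then have ae: "AE s in ?M. 1 / 2 * (weighted_norm (matrix_inv M) (vector_derivative X (at s within {0..t})))\<^sup>2 - U (X s)
      = (\<Sum>i\<in>UNIV. 1 / 2 * (speed t (Y i) s)\<^sup>2 + potential (a $ i) (b $ i) (Y i s))"
  proof eventually_elim
    case (elim s)
    have "((\<lambda>r. Y i r *\<^sub>R column i P) has_vector_derivative speed t (Y i) s *\<^sub>R column i P) (at s within {0..t})" for i
    proof -
      have "(Y i has_real_derivative speed t (Y i) s) (at s within {0..t})"
        using elim by (blast intro: has_field_derivative_at_within)
      from has_vector_derivative_scaleR[OF this has_vector_derivative_const] show ?thesis by simp
    qed
    then have "((\<lambda>r. \<Sum>i\<in>UNIV. Y i r *\<^sub>R column i P) has_vector_derivative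
        (\<Sum>i\<in>UNIV. speed t (Y i) s *\<^sub>R column i P)) (at s within {0..t})"
      by (rule has_vector_derivative_sum)
    from has_vector_derivative_add[OF this has_vector_derivative_const]
    have "((\<lambda>r. (\<Sum>i\<in>UNIV. Y i r *\<^sub>R column i P) + u0) has_vector_derivative
        (\<Sum>i\<in>UNIV. speed t (Y i) s *\<^sub>R column i P)) (at s within {0..t})"
      by simp
    moreover have "(\<lambda>r. (\<Sum>i\<in>UNIV. Y i r *\<^sub>R column i P) + u0) = X"
      by (rule ext, subst X) (simp add: matrix_mult_sum scalar_mult_eq_scaleR)
    ultimately have "(X has_vector_derivative P *v (\<chi> i. speed t (Y i) s)) (at s within {0..t})"
      by (simp add: matrix_mult_sum scalar_mult_eq_scaleR)
    then have "vector_derivative X (at s within {0..t}) = P *v (\<chi> i. speed t (Y i) s)"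
      using elim t by (intro vector_derivative_within_cbox[of 0 t, simplified]) auto
    moreover have "U (X s) = - (\<Sum>i\<in>UNIV. potential (a $ i) (b $ i) (Y i s))"
      by (simp add: X U total_potential_def)
    ultimately show ?case
      by (simp add: weighted_norm_matrix_inv[OF P M] sum.distrib sum_divide_distrib)
  qed
  define h where "h s = 1 / 2 * (weighted_norm (matrix_inv M) (vector_derivative X (at s within {0..t})))\<^sup>2 - U (X s)" for s
  define k where "k s = (\<Sum>i\<in>UNIV. 1 / 2 * (speed t (Y i) s)\<^sup>2 + potential (a $ i) (b $ i) (Y i s))" for s
  have k_int: "integrable ?M k"
    unfolding k_def by (intro Bochner_Integration.integrable_sum integrable_running_cost[OF Y_lip t])
  then have k_set: "set_integrable lebesgue {0..t} k"
    by (simp add: set_integrable_def integrable_restrict_space)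
  \<comment> \<open>Completeness of Lebesgue measure carries measurability over from the scalar
    integrands \<open>k\<close> to \<open>h\<close>.\<close>
  have "AE s in lebesgue. indicator {0..t} s *\<^sub>R k s = indicator {0..t} s *\<^sub>R h s"
    using ae unfolding h_def[symmetric] k_def[symmetric]
    by (simp add: AE_restrict_space_iff) (auto elim!: eventually_mono simp: indicator_def)
  moreover have "(\<lambda>s. indicator {0..t} s *\<^sub>R k s) \<in> borel_measurable lebesgue"
    using k_set unfolding set_integrable_def by (rule borel_measurable_integrable)
  ultimately have "(LINT s:{0..t}|lebesgue. h s) = (LINT s:{0..t}|lebesgue. k s)"
    unfolding set_lebesgue_integral_def
    by (intro integral_cong_AE) (auto intro: borel_measurable_AE elim: eventually_mono)
  also have "\<dots> = (\<integral>s. k s \<partial>?M)"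
    by (simp add: set_lebesgue_integral_def integral_restrict_space)
  also have "\<dots> = (\<Sum>i\<in>UNIV. running_cost (a $ i) (b $ i) t (Y i))"
    unfolding k_def running_cost_def
    by (intro Bochner_Integration.integral_sum integrable_running_cost[OF Y_lip t])
  finally show "cost M U \<Phi> t X = (\<Sum>i\<in>UNIV. running_cost (a $ i) (b $ i) t (Y i)) + \<Phi> (X 0)"
    by (simp add: cost_def h_def)
qed

section \<open>Dependence of the scalar value on the initial slope\<close>

lemma gamma_scalar_facts:
  assumes ab: "0 < a" "0 < b" and t: "0 < t"
  shows "gamma_scalar t x t p a b = x"
    and "\<exists>L. L-lipschitz_on {0..t} (\<lambda>s. gamma_scalar s x t p a b)"
    and "((\<lambda>s. gamma_scalar s x t p a b) has_real_derivative p) (at 0 within {0..t})"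
    and "V_scalar x t p a b = running_cost a b t (\<lambda>s. gamma_scalar s x t p a b) + p * gamma_scalar 0 x t p a b"
proof -
  obtain v where v: "extremal a b t (\<lambda>s. gamma_scalar s x t p a b) v" "v 0 = p" "gamma_scalar t x t p a b = x"
    "V_scalar x t p a b = v t * x - 1 / 2 * (\<integral>s. (v s)\<^sup>2 \<partial>lebesgue_on {0..t})"
    using gamma_scalar_extremal[OF ab t, of x p] unfolding extremal_with_value_def by blast
  show "gamma_scalar t x t p a b = x" by (fact v(3))
  show "\<exists>L. L-lipschitz_on {0..t} (\<lambda>s. gamma_scalar s x t p a b)"
    by (rule extremal_lipschitz[OF v(1)])
  show "((\<lambda>s. gamma_scalar s x t p a b) has_real_derivative p) (at 0 within {0..t})"
    using v(1,2) t by (auto simp: extremal_def)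
  show "V_scalar x t p a b = running_cost a b t (\<lambda>s. gamma_scalar s x t p a b) + p * gamma_scalar 0 x t p a b"
    using extremal_value[OF v(1) t] v by simp
qed

text \<open>The excess in speeds is weakened to a pointwise excess at \<open>s\<close>: time 0 is
  used for the dependence on \<open>p\<close>, general times for uniqueness.\<close>

lemma V_scalar_le_running_cost:
  assumes ab: "0 < a" "0 < b" and t: "0 < t"
    and y: "L-lipschitz_on {0..t} y" "y t = x" and s: "s \<in> {0..t}"
  shows "V_scalar x t p a b + (y s - gamma_scalar s x t p a b)\<^sup>2 / (2 * t) \<le> running_cost a b t y + p * y 0"
proof -
  let ?g = "\<lambda>s. gamma_scalar s x t p a b"
  obtain v where v: "extremal a b t ?g v" "v 0 = p"
    using gamma_scalar_extremal[OF ab t, of x p] unfolding extremal_with_value_def by blast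
  let ?D = "\<integral>s. (speed t y s - v s)\<^sup>2 \<partial>lebesgue_on {0..t}"
  have yt: "y t = ?g t" using y(2) gamma_scalar_facts(1)[OF ab t] by simp
  have "(y s - ?g s)\<^sup>2 / (2 * t) \<le> 1 / 2 * ?D"
    using deviation_le_speed_deviation[OF v(1) t y(1) yt s] t by (simp add: field_simps)
  then show ?thesis
    using extremal_minimises[OF v(1) t y(1) yt] gamma_scalar_facts(4)[OF ab t, of x p] v(2) by simp
qed

text \<open>The optimal curve for \<open>p\<close> is a competitor for \<open>q\<close>, and its
  cost changes only by \<open>q - p\<close> times its initial point.\<close>

lemma V_scalar_supergradient:
  assumes ab: "0 < a" "0 < b" and t: "0 < t"
  shows "V_scalar x t q a b + (gamma_scalar 0 x t p a b - gamma_scalar 0 x t q a b)\<^sup>2 / (2 * t)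
    \<le> V_scalar x t p a b + (q - p) * gamma_scalar 0 x t p a b"
proof -
  obtain L where "L-lipschitz_on {0..t} (\<lambda>s. gamma_scalar s x t p a b)"
    using gamma_scalar_facts(2)[OF ab t] by blast
  from V_scalar_le_running_cost[OF ab t this gamma_scalar_facts(1)[OF ab t], of 0 q]
  show ?thesis
    using gamma_scalar_facts(4)[OF ab t, of x p] t by (simp add: algebra_simps)
qed

text \<open>Adding the supergradient inequality to the one with \<open>p\<close> and
  \<open>q\<close> exchanged cancels the values and leaves
  \<open>d\<^sup>2 / t \<le> (q - p) * d\<close>.\<close>

lemma gamma_scalar_initial_lipschitz:
  assumes ab: "0 < a" "0 < b" and t: "0 < t"
  shows "\<bar>gamma_scalar 0 x t q a b - gamma_scalar 0 x t p a b\<bar> \<le> t * \<bar>q - p\<bar>"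
proof -
  define d where "d = gamma_scalar 0 x t p a b - gamma_scalar 0 x t q a b"
  have "d\<^sup>2 / (2 * t) + d\<^sup>2 / (2 * t) \<le> (q - p) * d"
    using V_scalar_supergradient[OF ab t, of x q p] V_scalar_supergradient[OF ab t, of x p q]
    by (simp add: d_def power2_commute algebra_simps)
  moreover have "d\<^sup>2 / (2 * t) + d\<^sup>2 / (2 * t) = d\<^sup>2 / t" by simp
  ultimately have "d\<^sup>2 / t \<le> (q - p) * d" by linarith
  then have "d\<^sup>2 \<le> t * ((q - p) * d)" using t by (simp add: field_simps)
  also have "\<dots> \<le> t * (\<bar>q - p\<bar> * \<bar>d\<bar>)"
    using t by (intro mult_left_mono) (auto simp: abs_mult[symmetric])
  finally have "\<bar>d\<bar> * \<bar>d\<bar> \<le> (t * \<bar>q - p\<bar>) * \<bar>d\<bar>" by (simp add: power2_eq_square)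
  then have "\<bar>d\<bar> \<le> t * \<bar>q - p\<bar>"
    using t unfolding mult_le_cancel_right by (cases "d = 0") auto
  then show ?thesis by (simp add: d_def abs_minus_commute)
qed

text \<open>Straight lines to \<open>x\<close> from the initial points 1 and -1 are competitors, and
  their linear initial costs are \<open>p\<close> and \<open>- p\<close>.\<close>

lemma V_scalar_coercive:
  assumes ab: "0 < a" "0 < b" and t: "0 < t"
  shows "\<exists>K. \<forall>p. V_scalar x t p a b \<le> K - \<bar>p\<bar>"
proof -
  define l where "l \<sigma> s = \<sigma> + (x - \<sigma>) * (s / t)" for \<sigma> s
  have l_lip: "(\<bar>x - \<sigma>\<bar> / t)-lipschitz_on {0..t} (l \<sigma>)" for \<sigma>
  proof (rule lipschitz_onI)
    fix r s
    have "l \<sigma> r - l \<sigma> s = (x - \<sigma>) / t * (r - s)"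
      using t by (simp add: l_def field_simps)
    then show "dist (l \<sigma> r) (l \<sigma> s) \<le> \<bar>x - \<sigma>\<bar> / t * dist r s"
      using t by (simp add: dist_real_def abs_mult)
  qed (use t in simp)
  have V_le: "V_scalar x t p a b \<le> running_cost a b t (l \<sigma>) + p * \<sigma>" for p \<sigma>
  proof -
    have l: "l \<sigma> t = x" "l \<sigma> 0 = \<sigma>" using t by (simp_all add: l_def)
    have "0 \<le> (\<sigma> - gamma_scalar 0 x t p a b)\<^sup>2 / (2 * t)" using t by simp
    moreover have "V_scalar x t p a b + (\<sigma> - gamma_scalar 0 x t p a b)\<^sup>2 / (2 * t) \<le> running_cost a b t (l \<sigma>) + p * \<sigma>"
      using V_scalar_le_running_cost[OF ab t l_lip[of \<sigma>] l(1), of 0 p] t by (simp add: l(2))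
    ultimately show ?thesis by linarith
  qed
  define K where "K = max (running_cost a b t (l 1)) (running_cost a b t (l (- 1)))"
  have "V_scalar x t p a b \<le> K - \<bar>p\<bar>" for p
    using V_le[of p 1] V_le[of p "- 1"] by (auto simp: K_def max_def abs_if)
  then show ?thesis by blast
qed

theorem proposition2p6:
  fixes \<Phi> U :: "real^'n \<Rightarrow> real"
    and P M :: "real^'n^'n"
    and u0 a b x :: "real^'n"
    and C \<delta> t :: real
  assumes "convex_on UNIV \<Phi>"
    and "C \<ge> 0" and "\<delta> \<ge> 0"
    and "\<And>x y. \<bar>\<Phi> x - \<Phi> y\<bar> \<le>
           C * norm (x - y) * (1 + nonneg_power (norm x) \<delta> + nonneg_power (norm y) \<delta>)"
    and "\<And>x. U x \<le> 0"
    and "piecewise_affine U"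
    and "concave_on UNIV U"
    and "one_homogeneous (\<lambda>x. U (x + u0))"
    and "invertible P"
    and "\<And>j. a $ j > 0" and "\<And>j. b $ j > 0"
    and "{x. U (x + u0) \<ge> -1} =
         convex hull (\<Union>j. {(1 / a $ j) *\<^sub>R column j P, - (1 / b $ j) *\<^sub>R column j P})"
    and "M = P ** transpose P"
    and "t > 0"
  shows "(\<exists>!p. V_maximizer P u0 a b \<Phi> x t p) \<and>
         (\<forall>p. V_maximizer P u0 a b \<Phi> x t p \<longrightarrow>
            optimal_trajectory M U \<Phi> x t (gamma_curve P u0 a b x t p) \<and>
            (\<forall>X. optimal_trajectory M U \<Phi> x t X \<longrightarrow>
               (\<forall>s\<in>{0..t}. X s = gamma_curve P u0 a b x t p s))) \<and>
         optimal_value M U \<Phi> x t = V_value P u0 a b \<Phi> x t"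
proof -
  note conv = assms(1) and P = assms(9) and ab = assms(10,11) and M = assms(13) and t = assms(14)
  have U: "U (P *v y + u0) = - total_potential a b y" for y
    by (rule concave_one_homogeneous_eq_total_potential[OF assms(5,8) P ab assms(12)])
  define \<Psi> where "\<Psi> y = \<Phi> (P *v y + u0)" for y
  define \<xi> where "\<xi> = matrix_inv P *v (x - u0)"
  define c where "c p s = (\<chi> i. gamma_scalar s (\<xi> $ i) t (p $ i) (a $ i) (b $ i))" for p s
  define G where "G p = (\<Sum>i\<in>UNIV. V_scalar (\<xi> $ i) t (p $ i) (a $ i) (b $ i))" for p
  note facts = gamma_scalar_facts[OF ab t]
  have curve: "gamma_curve P u0 a b x t p s = P *v c p s + u0" for p s
    by (simp add: gamma_curve_def c_def \<xi>_def)
  have objective: "V_objective P u0 a b \<Phi> x t p = ereal (G p) - legendre_fenchel \<Psi> p" for p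
    by (simp add: V_objective_def G_def \<Psi>_def[abs_def] \<xi>_def matrix_vector_mult_diff_distrib)
  have \<Psi>: "convex_on UNIV \<Psi>"
  proof (rule convex_onI)
    fix r :: real and y z assume r: "0 < r" "r < 1"
    have "P *v ((1 - r) *\<^sub>R y + r *\<^sub>R z) + u0 = (1 - r) *\<^sub>R (P *v y + u0) + r *\<^sub>R (P *v z + u0)"
      by (simp add: algebra_simps)
    then show "\<Psi> ((1 - r) *\<^sub>R y + r *\<^sub>R z) \<le> (1 - r) * \<Psi> y + r * \<Psi> z"
      unfolding \<Psi>_def using convex_onD[OF conv, of r "P *v y + u0" "P *v z + u0"] r by simp
  qed simp
  have super: "G q \<le> G p + (q - p) \<bullet> c p 0" for p q
  proof -
    have "V_scalar (\<xi> $ i) t (q $ i) (a $ i) (b $ i)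
        \<le> V_scalar (\<xi> $ i) t (p $ i) (a $ i) (b $ i) + (q - p) $ i * c p 0 $ i" for i
    proof -
      have "0 \<le> (gamma_scalar 0 (\<xi> $ i) t (p $ i) (a $ i) (b $ i)
          - gamma_scalar 0 (\<xi> $ i) t (q $ i) (a $ i) (b $ i))\<^sup>2 / (2 * t)"
        using t by simp
      then show ?thesis
        using V_scalar_supergradient[OF ab[of i] t, of "\<xi> $ i" "q $ i" "p $ i"] by (simp add: c_def)
    qed
    then show ?thesis
      unfolding G_def inner_vec_def sum.distrib[symmetric] by (intro sum_mono) simp
  qed
  have lip: "norm (c q 0 - c p 0) \<le> t * norm (q - p)" for p q
  proof -
    have "norm (c q 0 - c p 0) \<le> norm (t *\<^sub>R (q - p))"
      using gamma_scalar_initial_lipschitz[OF ab t] t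
      by (intro norm_le_componentwise_cart) (simp add: c_def abs_mult)
    then show ?thesis using t by simp
  qed
  have "\<forall>i. \<exists>K. \<forall>p. V_scalar (\<xi> $ i) t p (a $ i) (b $ i) \<le> K - \<bar>p\<bar>"
    using V_scalar_coercive[OF ab t] by blast
  then obtain K where K: "\<And>i p. V_scalar (\<xi> $ i) t p (a $ i) (b $ i) \<le> K i - \<bar>p\<bar>"
    by metis
  have coercive: "G p \<le> sum K UNIV - norm p" for p
  proof -
    have "G p \<le> (\<Sum>i\<in>UNIV. K i - \<bar>p $ i\<bar>)"
      unfolding G_def by (intro sum_mono K)
    then show ?thesis using norm_le_l1_cart[of p] by (simp add: sum_subtractf)
  qed
  note dual = conjugate_dual_maximum[OF \<Psi> super lip coercive]
  have max_iff: "V_maximizer P u0 a b \<Phi> x t p \<longleftrightarrow>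
      ereal (G p) - legendre_fenchel \<Psi> p = (SUP q. ereal (G q) - legendre_fenchel \<Psi> q)" for p
    by (simp add: V_maximizer_def V_value_def objective)
  have max_value: "V_value P u0 a b \<Phi> x t = ereal (G p - p \<bullet> c p 0 + \<Psi> (c p 0))"
    if p: "V_maximizer P u0 a b \<Phi> x t p" for p
  proof -
    have "V_value P u0 a b \<Phi> x t = ereal (G p) - legendre_fenchel \<Psi> p"
      using p by (simp add: V_maximizer_def objective)
    also have "\<dots> = ereal (G p - p \<bullet> c p 0 + \<Psi> (c p 0))"
      using dual(2)[OF p[unfolded max_iff]] by simp
    finally show ?thesis .
  qed
  \<comment> \<open>The affine minorant of \<Psi> with slope \<open>p\<close> makes the initial cost
    linear, so every coordinate can be bounded separately. At a maximiser this minorant touches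
    \<Psi> at \<open>c p 0\<close>, hence the bound is sharp for the explicit curve.\<close>
  have cost_ge: "G p - p \<bullet> c p 0 + \<Psi> (c p 0)
        + (\<Sum>i\<in>UNIV. ((matrix_inv P *v (X s - u0)) $ i - c p s $ i)\<^sup>2 / (2 * t)) \<le> cost M U \<Phi> t X"
    if p: "V_maximizer P u0 a b \<Phi> x t p" and X: "X \<in> admissible x t" and s: "s \<in> {0..t}" for p X s
  proof -
    obtain L where L: "L-lipschitz_on {0..t} X" "X t = x" using X by (auto simp: admissible_def)
    define Y where "Y i s = (matrix_inv P *v (X s - u0)) $ i" for i s
    obtain K where Y: "\<And>i. K-lipschitz_on {0..t} (Y i)"
      using cost_eq_sum_running_cost(1)[OF P M U L(1) t] unfolding Y_def[abs_def] by blast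
    define z where "z = (\<chi> i. Y i 0)"
    have z: "P *v z + u0 = X 0"
      by (simp add: z_def Y_def matrix_inv_mult_vector[OF P])
    have Yt: "Y i t = \<xi> $ i" for i using L by (simp add: Y_def \<xi>_def)
    have "(\<Sum>i\<in>UNIV. V_scalar (\<xi> $ i) t (p $ i) (a $ i) (b $ i) + (Y i s - c p s $ i)\<^sup>2 / (2 * t))
        \<le> (\<Sum>i\<in>UNIV. running_cost (a $ i) (b $ i) t (Y i) + p $ i * z $ i)"
      using V_scalar_le_running_cost[OF ab t Y Yt s] by (intro sum_mono) (simp add: c_def z_def)
    then have "G p + (\<Sum>i\<in>UNIV. (Y i s - c p s $ i)\<^sup>2 / (2 * t))
        \<le> (\<Sum>i\<in>UNIV. running_cost (a $ i) (b $ i) t (Y i)) + p \<bullet> z"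
      by (simp add: sum.distrib G_def inner_vec_def)
    moreover have "p \<bullet> z - \<Psi> z \<le> p \<bullet> c p 0 - \<Psi> (c p 0)"
      using legendre_fenchel_ge[of p z \<Psi>] dual(2)[OF p[unfolded max_iff]] by simp
    moreover have "cost M U \<Phi> t X = (\<Sum>i\<in>UNIV. running_cost (a $ i) (b $ i) t (Y i)) + \<Psi> z"
      using cost_eq_sum_running_cost(2)[OF P M U L(1) t, of \<Phi>] unfolding Y_def[abs_def] \<Psi>_def z .
    ultimately show ?thesis by (simp add: Y_def)
  qed
  have admissible: "gamma_curve P u0 a b x t p \<in> admissible x t" for p
  proof -
    have "\<forall>i. \<exists>L. L-lipschitz_on {0..t} (\<lambda>s. c p s $ i)"
      using facts(2) by (simp add: c_def)
    then obtain L where L: "\<And>i. (L i)-lipschitz_on {0..t} (\<lambda>s. c p s $ i)" by metis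
    define B where "B = onorm (\<lambda>v. P *v v) * sum L UNIV"
    have bl: "bounded_linear (\<lambda>v. P *v v)" by simp
    have "B-lipschitz_on {0..t} (gamma_curve P u0 a b x t p)"
    proof (rule lipschitz_onI)
      show "0 \<le> B"
        unfolding B_def using lipschitz_on_nonneg[OF L] onorm_pos_le[OF bl] by (simp add: sum_nonneg)
      fix r s assume rs: "r \<in> {0..t}" "s \<in> {0..t}"
      have "dist (gamma_curve P u0 a b x t p r) (gamma_curve P u0 a b x t p s) = norm (P *v (c p r - c p s))"
        by (simp add: curve dist_norm matrix_vector_mult_diff_distrib)
      also have "\<dots> \<le> onorm (\<lambda>v. P *v v) * norm (c p r - c p s)" by (rule onorm[OF bl])
      also have "norm (c p r - c p s) \<le> (\<Sum>i\<in>UNIV. \<bar>(c p r - c p s) $ i\<bar>)"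
        by (rule norm_le_l1_cart)
      also have "\<dots> \<le> (\<Sum>i\<in>UNIV. L i * dist r s)"
        using lipschitz_onD[OF L rs] by (intro sum_mono) (simp add: dist_real_def)
      finally show "dist (gamma_curve P u0 a b x t p r) (gamma_curve P u0 a b x t p s) \<le> B * dist r s"
        using onorm_pos_le[OF bl] by (simp add: B_def sum_distrib_right mult.assoc mult_left_mono)
    qed
    moreover have "c p t = \<xi>" by (simp add: c_def facts(1) vec_eq_iff)
    then have "gamma_curve P u0 a b x t p t = x"
      by (simp add: curve \<xi>_def matrix_inv_mult_vector[OF P])
    ultimately show ?thesis by (auto simp: admissible_def)
  qed
  \<comment> \<open>By \<open>facts(4)\<close> the running cost in each coordinate is the scalar
    value minus its linear initial cost.\<close>
  have cost_curve: "cost M U \<Phi> t (gamma_curve P u0 a b x t p) = G p - p \<bullet> c p 0 + \<Psi> (c p 0)" for p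
  proof -
    obtain L where L: "L-lipschitz_on {0..t} (gamma_curve P u0 a b x t p)"
      using admissible by (auto simp: admissible_def)
    have "(matrix_inv P *v (gamma_curve P u0 a b x t p s - u0)) $ i
        = gamma_scalar s (\<xi> $ i) t (p $ i) (a $ i) (b $ i)" for i s
      by (simp add: curve matrix_inv_mult_vector[OF P] c_def)
    then have "cost M U \<Phi> t (gamma_curve P u0 a b x t p) =
        (\<Sum>i\<in>UNIV. running_cost (a $ i) (b $ i) t (\<lambda>s. gamma_scalar s (\<xi> $ i) t (p $ i) (a $ i) (b $ i)))
        + \<Psi> (c p 0)"
      using cost_eq_sum_running_cost(2)[OF P M U L t, of \<Phi>] by (simp add: curve \<Psi>_def)
    also have "\<dots> = (\<Sum>i\<in>UNIV. V_scalar (\<xi> $ i) t (p $ i) (a $ i) (b $ i) - p $ i * c p 0 $ i) + \<Psi> (c p 0)"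
      using facts(4) by (simp add: c_def)
    finally show ?thesis by (simp add: G_def inner_vec_def sum_subtractf)
  qed
  have opt_value: "optimal_value M U \<Phi> x t = V_value P u0 a b \<Phi> x t"
    if p: "V_maximizer P u0 a b \<Phi> x t p" for p
    unfolding optimal_value_def max_value[OF p]
  proof (rule antisym)
    show "(INF X\<in>admissible x t. ereal (cost M U \<Phi> t X)) \<le> ereal (G p - p \<bullet> c p 0 + \<Psi> (c p 0))"
      by (rule INF_lower2[OF admissible[of p]]) (simp add: cost_curve)
    show "ereal (G p - p \<bullet> c p 0 + \<Psi> (c p 0)) \<le> (INF X\<in>admissible x t. ereal (cost M U \<Phi> t X))"
    proof (rule INF_greatest)
      fix X assume X: "X \<in> admissible x t"
      have "0 \<le> (\<Sum>i\<in>UNIV. ((matrix_inv P *v (X 0 - u0)) $ i - c p 0 $ i)\<^sup>2 / (2 * t))"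
        using t by (intro sum_nonneg) simp
      then show "ereal (G p - p \<bullet> c p 0 + \<Psi> (c p 0)) \<le> ereal (cost M U \<Phi> t X)"
        using cost_ge[OF p X, of 0] t by simp
    qed
  qed
  have optimal: "optimal_trajectory M U \<Phi> x t (gamma_curve P u0 a b x t p)"
    if p: "V_maximizer P u0 a b \<Phi> x t p" for p
    using admissible by (simp add: optimal_trajectory_def opt_value[OF p] max_value[OF p] cost_curve)
  have unique: "X s = gamma_curve P u0 a b x t p s"
    if p: "V_maximizer P u0 a b \<Phi> x t p" and X: "optimal_trajectory M U \<Phi> x t X" and s: "s \<in> {0..t}" for p X s
  proof -
    have "X \<in> admissible x t" "cost M U \<Phi> t X = G p - p \<bullet> c p 0 + \<Psi> (c p 0)"
      using X by (simp_all add: optimal_trajectory_def opt_value[OF p] max_value[OF p])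
    \<comment> \<open>An optimal cost leaves no room for the quadratic excess at time
      \<open>s\<close>.\<close>
    then have "(\<Sum>i\<in>UNIV. ((matrix_inv P *v (X s - u0)) $ i - c p s $ i)\<^sup>2 / (2 * t)) \<le> 0"
      using cost_ge[OF p _ s, of X] by simp
    then have "(\<Sum>i\<in>UNIV. ((matrix_inv P *v (X s - u0)) $ i - c p s $ i)\<^sup>2 / (2 * t)) = 0"
      using t by (intro antisym sum_nonneg) auto
    then have "\<forall>i. ((matrix_inv P *v (X s - u0)) $ i - c p s $ i)\<^sup>2 / (2 * t) = 0"
      using t by (subst (asm) sum_nonneg_eq_0_iff) auto
    then have "matrix_inv P *v (X s - u0) = c p s"
      using t by (simp add: vec_eq_iff)
    then have "P *v c p s = X s - u0"
      by (metis matrix_inv_mult_vector(1)[OF P])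
    then show ?thesis by (simp add: curve)
  qed
  obtain p where p: "V_maximizer P u0 a b \<Phi> x t p" using dual(1) max_iff by blast
  have "q = p" if q: "V_maximizer P u0 a b \<Phi> x t q" for q
  proof -
    have c_eq: "c q s = c p s" if "s \<in> {0..t}" for s
    proof -
      have "P *v c q s = P *v c p s"
        using unique[OF p optimal[OF q] that] by (simp add: curve)
      then show ?thesis by (metis matrix_inv_mult_vector(2)[OF P])
    qed
    have "q $ i = p $ i" for i
    proof -
      \<comment> \<open>The derivative at 0 is one-sided, but still unique because
        \<open>t > 0\<close>.\<close>
      have "((\<lambda>s. gamma_scalar s (\<xi> $ i) t (q $ i) (a $ i) (b $ i)) has_real_derivative p $ i) (at 0 within {0..t})"
        using c_eq t
        by (intro has_field_derivative_transform_within[OF facts(3), of 1]) (auto simp: c_def vec_eq_iff)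
      then show ?thesis
        using vector_derivative_within_interval_eq[OF _ t, of _ _ 0] facts(3) t
        by (metis atLeastAtMost_iff less_imp_le order_refl)
    qed
    then show ?thesis by (simp add: vec_eq_iff)
  qed
  then have "\<exists>!p. V_maximizer P u0 a b \<Phi> x t p" using p by blast
  then show ?thesis using optimal unique opt_value[OF p] by blast
qed

end
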